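(* Let $A\in\mathbb{R}^{N\times N}$, $B\in\mathbb{R}^{N\times q}$, $x_0\in\mathbb{R}^N$, $T>0$, $x_d\in L^2(0,T;\mathbb{R}^N)$, $Q\in\mathbb{R}^{N\times N}$ symmetric positive semi-definite and $R\in\mathbb{R}^{q\times q}$ symmetric positive definite. There exists a constant $C=C_{[A,B,x_0,Q,R,x_d,T]}$, depending only on $A,B,x_0,Q,R,x_d,T$ (and in particular not on the splitting, the probabilities or the temporal grid), such that the following holds. Let $A=\sum_{m=1}^M A_m$ be any splitting, $(p_\omega)_{\omega=1}^{2^M}$ any probabilities assigned to the subsets of $\{1,\dots,M\}$, and $0=t_0<t_1<\dots<t_K=T$ any temporal grid with maximal spacing $h$, such that (1) $\langle x,A_mx\rangle\le 0$ for all $x\in\mathbb{R}^N$ and all $m\in\{1,\dots,M\}$, and (2) $\sum_{\omega=1}^{2^M}p_\omega=1$ and $\pi_m>0$ for all $m\in\{1,\dots,M\}$. Let $u^*$ be the control that minimizes $J$ over $L^2(0,T;\mathbb{R}^q)$ and, for each $\boldsymbol\omega\in\Omega^K$, let $u_h^*(\boldsymbol\omega)$ be the control that minimizes $J_h(\boldsymbol\omega,\cdot)$ over $L^2(0,T;\mathbb{R}^q)$. Then $$\mathbb{E}\bigl[|J_h(u_h^* )-J(u^* )|\bigr]\le C\Bigl(\sqrt{h\,\mathrm{Var}[\mathcal{A}]}+h\,\mathrm{Var}[\mathcal{A}]\Bigr),$$ where $J_h(u_h^* )$ denotes the random variable $\boldsymbol\omega\mapsto J_h(\boldsymbol\ome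ga,u_h^*(\boldsymbol\omega))$.
   Context: $|\cdot|$ is the Euclidean norm and $\|\cdot\|$ the induced operator norm of matrices. Randomized splitting. $S_1,\dots,S_{2^M}$ is an enumeration of all subsets of $\{1,\dots,M\}$ (including the empty set); $\Omega=\{1,\dots,2^M\}$. Subset $S_\omega$ is given probability $p_\omega\ge 0$. The probability that index $m$ is selected is $\pi_m=\sum_{\omega:\,m\in S_\omega}p_\omega$. The grid spacings are $h_k=t_k-t_{k-1}$ and $h=\max_k h_k$. For $\boldsymbol\omega=(\omega_1,\dots,\omega_K)\in\Omega^K$ define the piecewise constant matrix $$\mathcal{A}_h(\boldsymbol\omega,t)=\sum_{m\in S_{\omega_k}}\frac{A_m}{\pi_m},\qquad t\in[t_{k-1},t_k).$$ The indices $\omega_k$ are chosen independently, i.e. $\Omega^K$ carries the probabilities $p(\boldsymbol\omega)=p_{\omega_1}p_{\omega_2}\cdots p_{\omega_K}$, and $\mathbb{E}[X]=\sum_{\boldsymbol\omega\in\Omega^K}X(\boldsymbol\omega)p(\boldsymbol\omega)$. Further $$\mathrm{Var}[\mathcal{A}]=\sum_{\omega=1}^{2^M}\Bigl\|\sum_{m\in S_\omega}\frac{A_m}{\pi_m}-A\Bigr\|^2p_\omega .$$ Cost functionals. For $u\in L^2(0,T;\mathbb{R}^q)$ let $x$ solve $\dot x=Ax+Bu$, $x(0)=x_0$, and let $x_h(\boldsymbol\omega,\cdot)$ solve $\dot x_h(\boldsymbol\omega,t)=\mathcal{A}_h(\boldsymbol\omega,t)x_h(\boldsymbol\omega,t)+Bu(t)$,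 $x_h(\boldsymbol\omega,0)=x_0$. Define $$J(u)=\tfrac12\int_0^T\bigl((x(t)-x_d(t))^\top Q(x(t)-x_d(t))+u(t)^\top Ru(t)\bigr)\,dt,$$ $$J_h(\boldsymbol\omega,u)=\tfrac12\int_0^T\bigl((x_h(\boldsymbol\omega,t)-x_d(t))^\top Q(x_h(\boldsymbol\omega,t)-x_d(t))+u(t)^\top Ru(t)\bigr)\,dt.$$ Since $R$ is positive definite, the minimizers of $J$ and of $J_h(\boldsymbol\omega,\cdot)$ exist and are unique. *)

theory Defs
  imports "HOL-Analysis.Analysis"
begin

definition L2 :: "real \<Rightarrow> (real \<Rightarrow> 'a::euclidean_space) set" where
  "L2 T = {u. u \<in> borel_measurable (lebesgue_on {0..T}) \<and>
              integrable (lebesgue_on {0..T}) (\<lambda>t. (norm (u t))\<^sup>2)}"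

text \<open>The library norm on matrices is the Frobenius norm, so the norm induced by the
  Euclidean norm has to be taken as the operator norm of the associated linear map.\<close>

definition opnorm :: "real^'n^'m \<Rightarrow> real" where
  "opnorm X = onorm (\<lambda>v. X *v v)"

definition symmetric_matrix :: "real^'n^'n \<Rightarrow> bool" where
  "symmetric_matrix X \<longleftrightarrow> transpose X = X"

definition pos_semidef :: "real^'n^'n \<Rightarrow> bool" where
  "pos_semidef X \<longleftrightarrow> (\<forall>v. 0 \<le> v \<bullet> (X *v v))"

definition pos_def :: "real^'n^'n \<Rightarrow> bool" where
  "pos_def X \<longleftrightarrow> (\<forall>v. v \<noteq> 0 \<longrightarrow> 0 < v \<bullet> (X *v v))"

text \<open>For a control that is merely square integrable, the initial value problem
  \<open>x' = F(t) x + B u\<close>, \<open>x(0) = x0\<close> on \<open>[0, T]\<close> is understood in the sense of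
  Caratheodory, i.e. as the associated integral equation. Since the integrand is integrable, this
  says that \<open>x\<close> is absolutely continuous and satisfies the differential equation almost
  everywhere.\<close>

definition solves_ivp ::
  "real \<Rightarrow> (real \<Rightarrow> real^'n^'n) \<Rightarrow> real^'q^'n \<Rightarrow> real^'n \<Rightarrow> (real \<Rightarrow> real^'q)
     \<Rightarrow> (real \<Rightarrow> real^'n) \<Rightarrow> bool" where
  "solves_ivp T F B x0 u x \<longleftrightarrow>
     continuous_on {0..T} x \<and>
     (\<forall>t\<in>{0..T}. x t = x0 + (LINT s|lebesgue_on {0..t}. F s *v x s + B *v u s))"

text \<open>Solutions are unique on \<open>[0, T]\<close> only; their values outside this interval are
  irrelevant, whence a choice operator instead of a definite description.\<close>

definition state ::
  "real \<Rightarrow> (real \<Rightarrow> real^'n^'n) \<Rightarrow> real^'q^'n \<Rightarrow> real^'n \<Rightarrow> (real \<Rightarrow> real^'q)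
     \<Rightarrow> real \<Rightarrow> real^'n" where
  "state T F B x0 u = (SOME x. solves_ivp T F B x0 u x)"

definition cost ::
  "real \<Rightarrow> real^'n^'n \<Rightarrow> real^'q^'q \<Rightarrow> (real \<Rightarrow> real^'n) \<Rightarrow> (real \<Rightarrow> real^'n)
     \<Rightarrow> (real \<Rightarrow> real^'q) \<Rightarrow> real" where
  "cost T Q R xd x u =
     1/2 * (LINT t|lebesgue_on {0..T}.
              (x t - xd t) \<bullet> (Q *v (x t - xd t)) + u t \<bullet> (R *v u t))"

definition J ::
  "real \<Rightarrow> real^'n^'n \<Rightarrow> real^'q^'n \<Rightarrow> real^'n \<Rightarrow> real^'n^'n \<Rightarrow> real^'q^'q
     \<Rightarrow> (real \<Rightarrow> real^'n) \<Rightarrow> (real \<Rightarrow> real^'q) \<Rightarrow> real" where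
  "J T A B x0 Q R xd u = cost T Q R xd (state T (\<lambda>t. A) B x0 u) u"

text \<open>In what follows, \<open>S 1, ..., S (2^M)\<close> enumerates the subsets of
  \<open>{1..M}\<close>, \<open>p i\<close> is the probability of \<open>S i\<close>, \<open>Am 1, ..., Am M\<close> are
  the matrices of the splitting, and \<open>tg 0, ..., tg K\<close> are the grid points.\<close>

definition sel_prob :: "nat \<Rightarrow> (nat \<Rightarrow> nat set) \<Rightarrow> (nat \<Rightarrow> real) \<Rightarrow> nat \<Rightarrow> real" where
  "sel_prob M S p m = (\<Sum>i\<in>{i\<in>{1..2^M}. m \<in> S i}. p i)"

definition sampled_matrix ::
  "nat \<Rightarrow> (nat \<Rightarrow> nat set) \<Rightarrow> (nat \<Rightarrow> real) \<Rightarrow> (nat \<Rightarrow> real^'n^'n) \<Rightarrow> nat \<Rightarrow> real^'n^'n" where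
  "sampled_matrix M S p Am i = (\<Sum>m\<in>S i. (1 / sel_prob M S p m) *\<^sub>R Am m)"

text \<open>The grid intervals \<open>[tg (k-1), tg k)\<close> are pairwise disjoint, so at most one
  summand is nonzero.\<close>

definition A_h ::
  "nat \<Rightarrow> (nat \<Rightarrow> nat set) \<Rightarrow> (nat \<Rightarrow> real) \<Rightarrow> (nat \<Rightarrow> real^'n^'n) \<Rightarrow> nat \<Rightarrow> (nat \<Rightarrow> real)
     \<Rightarrow> (nat \<Rightarrow> nat) \<Rightarrow> real \<Rightarrow> real^'n^'n" where
  "A_h M S p Am K tg \<omega> t =
     (\<Sum>k=1..K. if t \<in> {tg (k-1)..<tg k} then sampled_matrix M S p Am (\<omega> k) else 0)"

definition J_h ::
  "real \<Rightarrow> real^'q^'n \<Rightarrow> real^'n \<Rightarrow> real^'n^'n \<Rightarrow> real^'q^'q \<Rightarrow> (real \<Rightarrow> real^'n)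
     \<Rightarrow> nat \<Rightarrow> (nat \<Rightarrow> nat set) \<Rightarrow> (nat \<Rightarrow> real) \<Rightarrow> (nat \<Rightarrow> real^'n^'n) \<Rightarrow> nat \<Rightarrow> (nat \<Rightarrow> real)
     \<Rightarrow> (nat \<Rightarrow> nat) \<Rightarrow> (real \<Rightarrow> real^'q) \<Rightarrow> real" where
  "J_h T B x0 Q R xd M S p Am K tg \<omega> u =
     cost T Q R xd (state T (A_h M S p Am K tg \<omega>) B x0 u) u"

text \<open>\<open>\<Omega>\<^sup>K\<close>, with a tuple represented as an extensional function on \<open>{1..K}\<close>.\<close>

definition Omega_K :: "nat \<Rightarrow> nat \<Rightarrow> (nat \<Rightarrow> nat) set" where
  "Omega_K M K = {1..K} \<rightarrow>\<^sub>E {1..2^M}"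

definition expect ::
  "nat \<Rightarrow> nat \<Rightarrow> (nat \<Rightarrow> real) \<Rightarrow> ((nat \<Rightarrow> nat) \<Rightarrow> real) \<Rightarrow> real" where
  "expect M K p X = (\<Sum>\<omega>\<in>Omega_K M K. X \<omega> * (\<Prod>k=1..K. p (\<omega> k)))"

definition Var_A ::
  "nat \<Rightarrow> (nat \<Rightarrow> nat set) \<Rightarrow> (nat \<Rightarrow> real) \<Rightarrow> (nat \<Rightarrow> real^'n^'n) \<Rightarrow> real^'n^'n \<Rightarrow> real" where
  "Var_A M S p Am A = (\<Sum>i=1..2^M. (opnorm (sampled_matrix M S p Am i - A))\<^sup>2 * p i)"

definition max_spacing :: "nat \<Rightarrow> (nat \<Rightarrow> real) \<Rightarrow> real" where
  "max_spacing K tg = Max ((\<lambda>k. tg k - tg (k-1)) ` {1..K})"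

end

theory Submission
  imports Defs
begin

text \<open>Write \<open>x\<close> and \<open>x\<^sub>h\<close> for the exact and the randomly split state under the fixed control
  \<open>u\<^sup>*\<close>. Since \<open>J\<^sub>h(u\<^sub>h\<^sup>*) \<le> J\<^sub>h(u\<^sup>*)\<close>,
  the gap \<open>|J\<^sub>h(u\<^sub>h\<^sup>*) - J(u\<^sup>*)|\<close> is at most \<open>|J\<^sub>h(u\<^sup>*) - J(u\<^sup>*)| + (J\<^sub>h(u\<^sup>*) - J\<^sub>h(u\<^sub>h\<^sup>*))\<close>,
  and both terms have bounds in which the random control \<open>u\<^sub>h\<^sup>*\<close> no longer occurs.

  The first term compares one deterministic control in two systems, so it is bounded by
  \<open>\<integral>|Q(x - x\<^sub>d)| |x\<^sub>h - x|\<close> and \<open>\<integral>|x\<^sub>h - x|\<^sup>2\<close> (lemma \<open>cost_perturbation\<close>). The first integral is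
  responsible for the square root in the rate.

  For the second term put \<open>v = u\<^sub>h\<^sup>* - u\<^sup>*\<close> and let \<open>y\<close>, \<open>y\<^sub>h\<close> be the responses of the two systems
  to \<open>v\<close>. Expand the quadratic functional \<open>J\<^sub>h\<close> at \<open>u\<^sup>*\<close> and subtract the stationarity
  condition of \<open>J\<close> at \<open>u\<^sup>*\<close>. What remains linear in \<open>v\<close> is \<open>\<integral>Q(x\<^sub>h - x) \<bullet> y\<^sub>h\<close> and
  \<open>\<integral>Q(x - x\<^sub>d) \<bullet> (y\<^sub>h - y)\<close>. The latter contains the response error of a random control, but by
  duality it equals \<open>\<integral>(\<phi>\<^sub>h - \<phi>) \<bullet> Bv\<close>, where the adjoint states \<open>\<phi>\<close>, \<open>\<phi>\<^sub>h\<close> are both driven by the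
  deterministic \<open>Q(x - x\<^sub>d)\<close>. Young's inequality absorbs \<open>v\<close> into the coercive term
  \<open>\<integral>v \<bullet> Rv\<close>, and \<open>\<integral>|x\<^sub>h - x|\<^sup>2\<close> and \<open>\<integral>|\<phi>\<^sub>h - \<phi>|\<^sup>2\<close> are left (lemma \<open>suboptimality\<close>).

  It remains to show \<open>E|x\<^sub>h(t) - x(t)|\<^sup>2 \<le> C h Var\<close> for a deterministic forcing (lemma
  \<open>expected_error\<close>); the adjoint is the same kind of system run backwards in time. The error \<open>e\<close> solves
  \<open>e' = A\<^sub>h e + (A\<^sub>h - A) x\<close>, and dissipativity gives \<open>|e(t)|\<^sup>2 \<le> 2 \<integral>e \<bullet> (A\<^sub>h - A) x\<close> with no
  contribution of \<open>A\<^sub>h e\<close>; no bound of \<open>A\<^sub>h\<close> uniform in the splitting is available. On a grid cell \<open>[t\<^sub>k\<^sub>-\<^sub>1, t\<^sub>k)\<close> the error at the left end point is independent of the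
  sample in use and that sample has mean \<open>A\<close>, so in expectation \<open>e\<close> may be replaced by
  its increment over a time at most \<open>h\<close>. As \<open>e' = (A\<^sub>h - A) x\<^sub>h + A e\<close>, this increment yields
  \<open>h |A\<^sub>h - A|\<^sup>2\<close> plus a term for Gronwall's inequality.

  The constant may not depend on \<open>u\<^sup>*\<close>; this is ensured by \<open>\<alpha>/2 \<integral>|u\<^sup>*|\<^sup>2 \<le> J(u\<^sup>*) \<le> J(0)\<close>.\<close>

section \<open>Absolutely continuous functions\<close>

lemma integrable_inner_continuous:
  fixes a y :: "real \<Rightarrow> 'a::euclidean_space"
  assumes "a absolutely_integrable_on {s..t}" "continuous_on {s..t} y"
  shows "(\<lambda>r. a r \<bullet> y r) absolutely_integrable_on {s..t}"
proof -
  have "(\<lambda>r. y r \<bullet> a r) absolutely_integrable_on {s..t}"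
  proof (rule absolutely_integrable_bounded_measurable_product[where h="(\<bullet>)" and f=y and g=a])
    show "bilinear ((\<bullet>) :: 'a \<Rightarrow> _)"
      by (simp add: bilinear_def linear_iff inner_add_left inner_add_right)
    show "y \<in> borel_measurable (lebesgue_on {s..t})"
      using assms(2) by (simp add: continuous_imp_measurable_on_sets_lebesgue)
    show "bounded (y ` {s..t})"
      using assms(2) by (simp add: compact_continuous_image compact_imp_bounded)
  qed (use assms in auto)
  then show ?thesis by (simp add: inner_commute)
qed

lemma integral_increment:
  fixes a :: "real \<Rightarrow> 'a::euclidean_space"
  assumes "a integrable_on {0..T}" "0 \<le> s" "s \<le> t" "t \<le> T"
  shows "integral {0..t} a - integral {0..s} a = integral {s..t} a"
proof -
  have "a integrable_on {0..t}"
    by (rule integrable_on_subinterval[OF assms(1)]) (use assms in auto)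
  with Henstock_Kurzweil_Integration.integral_combine[of 0 s t a] assms
  show ?thesis by (simp add: algebra_simps)
qed

text \<open>Let \<open>H\<close> be the difference of the two sides as a function of the end point. On a short interval
  the factors \<open>x\<close> and \<open>y\<close> oscillate by at most \<open>e\<close>, so the increment of \<open>H\<close> is at most \<open>e\<close> times the
  integral of \<open>|a| + |b|\<close> there. Such bounds add up over adjacent intervals, and \<open>e\<close> is arbitrary,
  whence \<open>H\<close> is constant. No pointwise derivative is used, since \<open>a\<close> and \<open>b\<close> are merely integrable.\<close>

lemma absolutely_continuous_product_rule:
  fixes a b :: "real \<Rightarrow> 'a::euclidean_space"
  assumes T: "0 \<le> T"
    and a: "a absolutely_integrable_on {0..T}" and b: "b absolutely_integrable_on {0..T}"
    and x: "\<And>t. t \<in> {0..T} \<Longrightarrow> x t = x0 + integral {0..t} a"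
    and y: "\<And>t. t \<in> {0..T} \<Longrightarrow> y t = y0 + integral {0..t} b"
  shows "x T \<bullet> y T = x0 \<bullet> y0 + integral {0..T} (\<lambda>t. a t \<bullet> y t + x t \<bullet> b t)"
proof -
  have ai: "a integrable_on {0..T}" and bi: "b integrable_on {0..T}"
    using a b by (auto intro: set_lebesgue_integral_eq_integral(1))
  have "continuous_on {0..T} (\<lambda>t. x0 + integral {0..t} a)"
    by (intro continuous_intros indefinite_integral_continuous_1 ai)
  then have cx: "continuous_on {0..T} x" by (rule continuous_on_eq) (simp add: x)
  have "continuous_on {0..T} (\<lambda>t. y0 + integral {0..t} b)"
    by (intro continuous_intros indefinite_integral_continuous_1 bi)
  then have cy: "continuous_on {0..T} y" by (rule continuous_on_eq) (simp add: y)
  define p where "p = (\<lambda>t. a t \<bullet> y t + x t \<bullet> b t)"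
  define H where "H = (\<lambda>t. x t \<bullet> y t - integral {0..t} p)"
  define q where "q = (\<lambda>r. norm (a r) + norm (b r))"
  define N where "N = (\<lambda>t. integral {0..t} q)"
  have pa: "p absolutely_integrable_on {0..T}"
    unfolding p_def using integrable_inner_continuous[OF a cy] integrable_inner_continuous[OF b cx]
    by (intro set_integral_add) (simp_all add: inner_commute)
  then have pint: "p integrable_on {0..T}" by (rule set_lebesgue_integral_eq_integral(1))
  have qint: "q integrable_on {0..T}"
    unfolding q_def using a b by (intro integrable_add) (auto simp: absolutely_integrable_on_def)
  have N0: "N s \<le> N t" if "0 \<le> s" "s \<le> t" "t \<le> T" for s t
  proof -
    have "0 \<le> integral {s..t} q"
      by (rule Henstock_Kurzweil_Integration.integral_nonneg)
        (use that in \<open>auto simp: q_def intro: integrable_on_subinterval[OF qint, unfolded q_def]\<close>)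
    with integral_increment[OF qint that] show ?thesis by (simp add: N_def)
  qed
  have local: "\<bar>H t - H s\<bar> \<le> e * (N t - N s)"
    if st: "0 \<le> s" "s \<le> t" "t \<le> T"
      and osc: "\<And>r. r \<in> {s..t} \<Longrightarrow> norm (y t - y r) \<le> e \<and> norm (x s - x r) \<le> e" for s t e
  proof -
    have sub: "{s..t} \<subseteq> {0..T}" using st by auto
    have ia: "a integrable_on {s..t}" and ib: "b integrable_on {s..t}"
      and ip: "p integrable_on {s..t}" and iq: "q integrable_on {s..t}"
      using ai bi pint qint sub by (auto intro: integrable_on_subinterval)
    have 1: "x t - x s = integral {s..t} a" "y t - y s = integral {s..t} b"
      using integral_increment[OF ai st] integral_increment[OF bi st] st x y by auto
    have i1: "(\<lambda>r. a r \<bullet> y t) integrable_on {s..t}" and i2: "(\<lambda>r. x s \<bullet> b r) integrable_on {s..t}"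
      using integrable_linear[OF ia bounded_linear_inner_left] integrable_linear[OF ib bounded_linear_inner_right]
      by (simp_all add: o_def)
    have 2: "integral {s..t} (\<lambda>r. a r \<bullet> y t) = (x t - x s) \<bullet> y t"
      "integral {s..t} (\<lambda>r. x s \<bullet> b r) = x s \<bullet> (y t - y s)"
      using integral_linear[OF ia bounded_linear_inner_left, of "y t"]
        integral_linear[OF ib bounded_linear_inner_right, of "x s"] 1
      by (simp_all add: o_def)
    have "H t - H s = x t \<bullet> y t - x s \<bullet> y s - integral {s..t} p"
      unfolding H_def using integral_increment[OF pint st] by simp
    also have "\<dots> = integral {s..t} (\<lambda>r. a r \<bullet> y t + x s \<bullet> b r) - integral {s..t} p"
      using Henstock_Kurzweil_Integration.integral_add[OF i1 i2] 2 by (simp add: inner_diff_left inner_diff_right)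
    also have "\<dots> = integral {s..t} (\<lambda>r. a r \<bullet> y t + x s \<bullet> b r - p r)"
      by (rule Henstock_Kurzweil_Integration.integral_diff[symmetric]) (use i1 i2 ip in \<open>auto intro: integrable_add\<close>)
    finally have eq: "H t - H s = integral {s..t} (\<lambda>r. a r \<bullet> y t + x s \<bullet> b r - p r)" .
    have "norm (integral {s..t} (\<lambda>r. a r \<bullet> y t + x s \<bullet> b r - p r)) \<le> integral {s..t} (\<lambda>r. e * q r)"
    proof (rule integral_norm_bound_integral)
      show "(\<lambda>r. a r \<bullet> y t + x s \<bullet> b r - p r) integrable_on {s..t}"
        using i1 i2 ip by (intro integrable_diff integrable_add)
      show "(\<lambda>r. e * q r) integrable_on {s..t}"
        using integrable_cmul[OF iq, of e] by simp
    next
      fix r assume r: "r \<in> {s..t}"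
      have "a r \<bullet> y t + x s \<bullet> b r - p r = a r \<bullet> (y t - y r) + (x s - x r) \<bullet> b r"
        by (simp add: p_def algebra_simps)
      also have "norm \<dots> \<le> norm (a r) * norm (y t - y r) + norm (x s - x r) * norm (b r)"
        unfolding real_norm_def
        by (intro order_trans[OF abs_triangle_ineq] add_mono Cauchy_Schwarz_ineq2)
      also have "\<dots> \<le> norm (a r) * e + e * norm (b r)"
        using osc[OF r] by (intro add_mono mult_left_mono mult_right_mono) auto
      finally show "norm (a r \<bullet> y t + x s \<bullet> b r - p r) \<le> e * q r" by (simp add: q_def algebra_simps)
    qed
    also have "\<dots> = e * (N t - N s)"
      unfolding N_def using integral_increment[OF qint st] by simp
    finally show ?thesis using eq by simp
  qed
  have "\<bar>H T - H 0\<bar> \<le> e * N T" if e: "e > 0" for e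
  proof -
    have "uniformly_continuous_on {0..T} x" "uniformly_continuous_on {0..T} y"
      using cx cy by (auto intro: compact_uniformly_continuous)
    then obtain d1 d2 where d: "d1 > 0" "d2 > 0"
      and d1: "\<And>r s. r \<in> {0..T} \<Longrightarrow> s \<in> {0..T} \<Longrightarrow> dist r s < d1 \<Longrightarrow> dist (x r) (x s) < e"
      and d2: "\<And>r s. r \<in> {0..T} \<Longrightarrow> s \<in> {0..T} \<Longrightarrow> dist r s < d2 \<Longrightarrow> dist (y r) (y s) < e"
      unfolding uniformly_continuous_on_def using e by metis
    define d where "d = min d1 d2 / 2"
    have dp: "d > 0" "d < d1" "d < d2" using d by (auto simp: d_def)
    have chain: "\<bar>H t - H s\<bar> \<le> e * (N t - N s)"
      if "0 \<le> s" "s \<le> t" "t \<le> T" "t - s \<le> real n * d" for n s t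
      using that
    proof (induction n arbitrary: t)
      case 0
      then have "s = t" by simp
      then show ?case by simp
    next
      case (Suc n)
      define m where "m = max s (t - d)"
      have m: "0 \<le> m" "s \<le> m" "m \<le> t" "m \<le> T" "m - s \<le> real n * d" "t - m \<le> d"
        using Suc.prems dp by (auto simp: m_def algebra_simps)
      have "\<bar>H m - H s\<bar> \<le> e * (N m - N s)" using Suc.IH[of m] m Suc.prems by auto
      moreover have "\<bar>H t - H m\<bar> \<le> e * (N t - N m)"
      proof (rule local)
        fix r assume r: "r \<in> {m..t}"
        have "dist (y t) (y r) < e" "dist (x m) (x r) < e"
          using r m Suc.prems dp by (auto intro!: d1 d2 simp: dist_real_def)
        then show "norm (y t - y r) \<le> e \<and> norm (x m - x r) \<le> e" by (simp add: dist_norm)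
      qed (use m Suc.prems in auto)
      ultimately show ?case by (simp add: algebra_simps)
    qed
    obtain n where "T / d \<le> real n" using real_arch_simple by blast
    then have "\<bar>H T - H 0\<bar> \<le> e * (N T - N 0)"
      using T dp by (intro chain[of _ _ n]) (auto simp: field_simps)
    then show ?thesis by (simp add: N_def)
  qed
  then have *: "\<And>e. e > 0 \<Longrightarrow> \<bar>H T - H 0\<bar> \<le> e * N T" .
  have "N T \<ge> 0" using N0[of 0 T] T by (simp add: N_def)
  have "\<bar>H T - H 0\<bar> \<le> 0 + e" if "e > 0" for e
  proof -
    have "\<bar>H T - H 0\<bar> \<le> e / (N T + 1) * N T" using *[of "e / (N T + 1)"] that \<open>N T \<ge> 0\<close> by simp
    also have "\<dots> \<le> e" using that \<open>N T \<ge> 0\<close> by (simp add: field_simps)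
    finally show ?thesis by simp
  qed
  then have "H T = H 0" using field_le_epsilon[of "\<bar>H T - H 0\<bar>" 0] by auto
  then show ?thesis using x[of 0] y[of 0] T by (simp add: H_def p_def)
qed

text \<open>With \<open>I\<close> the primitive of \<open>psi\<close>, the hypothesis says \<open>I' \<le> c + k I\<close>, so
  \<open>exp(-k t) (c + k I(t))\<close> decreases.\<close>

lemma gronwall_integral:
  fixes psi :: "real \<Rightarrow> real"
  assumes "0 \<le> T" "continuous_on {0..T} psi" "k \<ge> 0"
    and le: "\<And>t. t \<in> {0..T} \<Longrightarrow> psi t \<le> c + k * integral {0..t} psi"
    and t: "t \<in> {0..T}"
  shows "psi t \<le> c * exp (k * t)"
proof -
  define I where "I = (\<lambda>t. integral {0..t} psi)"
  define G where "G = (\<lambda>t. exp (- k * t) * (c + k * I t))"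
  have dI: "(I has_real_derivative psi s) (at s)" if "0 < s" "s < T" for s
    using integral_has_real_derivative[OF assms(2), of s] that
    by (simp add: I_def at_within_Icc_at)
  have cI: "continuous_on {0..T} I"
    unfolding I_def by (intro indefinite_integral_continuous_1 integrable_continuous_real assms)
  have "G t \<le> G 0"
  proof (rule DERIV_nonpos_imp_decreasing_open[where f=G])
    show "0 \<le> t" using t by simp
    show "continuous_on {0..t} G"
      unfolding G_def using t by (intro continuous_intros continuous_on_subset[OF cI]) auto
    fix s assume s: "0 < s" "s < t"
    have "(G has_real_derivative exp (- k * s) * (k * psi s) + (- k) * exp (- k * s) * (c + k * I s)) (at s)"
      unfolding G_def using s t
      by (auto intro!: derivative_eq_intros dI simp: algebra_simps)
    moreover have "exp (- k * s) * (k * psi s) + (- k) * exp (- k * s) * (c + k * I s)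
        = exp (- k * s) * k * (psi s - (c + k * I s))" by (simp add: algebra_simps)
    moreover have "\<dots> \<le> 0"
      using le[of s] s t \<open>k \<ge> 0\<close> by (intro mult_nonneg_nonpos) (auto simp: I_def)
    ultimately show "\<exists>y. (G has_real_derivative y) (at s) \<and> y \<le> 0" by metis
  qed
  then have "c + k * I t \<le> c * exp (k * t)"
    by (simp add: G_def I_def exp_minus field_simps)
  then show ?thesis using le[OF t] by (simp add: I_def)
qed

section \<open>Linear Caratheodory equations\<close>

lemma norm_mult_le_opnorm: "norm (X *v v) \<le> opnorm X * norm v"
  unfolding opnorm_def by (rule onorm) simp

lemma opnorm_nonneg: "0 \<le> opnorm X"
  unfolding opnorm_def by (rule onorm_pos_le) simp

lemma inner_transpose_mult:
  fixes X :: "real^'n^'m"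
  shows "(transpose X *v v) \<bullet> w = v \<bullet> (X *v w)"
  by (simp add: dot_lmul_matrix)

lemma opnorm_transpose_le:
  fixes X :: "real^'n^'m"
  shows "opnorm (transpose X) \<le> opnorm X"
  unfolding opnorm_def[of "transpose X"]
proof (rule onorm_le)
  fix v :: "real^'m"
  let ?w = "transpose X *v v"
  have "norm ?w * norm ?w = v \<bullet> (X *v ?w)"
    by (simp only: inner_transpose_mult[symmetric] power2_norm_eq_inner[symmetric] power2_eq_square)
  also have "\<dots> \<le> norm v * (opnorm X * norm ?w)"
    by (intro order_trans[OF norm_cauchy_schwarz] mult_left_mono norm_mult_le_opnorm) auto
  finally have "norm ?w * norm ?w \<le> (opnorm X * norm v) * norm ?w" by (simp add: mult_ac)
  then show "norm ?w \<le> opnorm X * norm v"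
    using opnorm_nonneg[of X] by (cases "norm ?w = 0") (auto simp: mult_le_cancel_right)
qed

definition dissipative :: "real^'n^'n \<Rightarrow> bool" where
  "dissipative X \<longleftrightarrow> (\<forall>v. v \<bullet> (X *v v) \<le> 0)"

text \<open>Measurability and boundedness of the coefficient make \<open>F x\<close> integrable for continuous \<open>x\<close>.\<close>

definition admissible :: "real \<Rightarrow> (real \<Rightarrow> real^'n^'n) \<Rightarrow> bool" where
  "admissible T F \<longleftrightarrow> F \<in> borel_measurable (lebesgue_on {0..T}) \<and> bounded (F ` {0..T})"

text \<open>The initial value problem of \<open>solves_ivp\<close> for a general forcing term, with the gauge integral in place of
  the Lebesgue integral; the two agree on all integrands that occur, see \<open>solves_ivp_iff\<close>.\<close>

definition lin_sol ::
  "real \<Rightarrow> (real \<Rightarrow> real^'n^'n) \<Rightarrow> (real \<Rightarrow> real^'n) \<Rightarrow> real^'n \<Rightarrow> (real \<Rightarrow> real^'n) \<Rightarrow> bool" where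
  "lin_sol T F f x0 x \<longleftrightarrow>
     continuous_on {0..T} x \<and> (\<forall>t\<in>{0..T}. x t = x0 + integral {0..t} (\<lambda>s. F s *v x s + f s))"

lemma admissible_const: "admissible T (\<lambda>t. X)"
  by (auto simp: admissible_def image_constant_conv)

lemma admissible_subinterval:
  assumes "admissible T F" "t \<le> T"
  shows "admissible t F"
proof -
  have sub: "{0..t} \<subseteq> {0..T}" using assms by auto
  have "F \<in> borel_measurable (lebesgue_on {0..t})"
    by (rule measurable_restrict_mono[OF _ sub]) (use assms(1) in \<open>simp add: admissible_def\<close>)
  moreover have "bounded (F ` {0..t})"
    using assms(1) sub by (auto simp: admissible_def intro: bounded_subset[OF _ image_mono])
  ultimately show ?thesis by (simp add: admissible_def)
qed

lemma bilinear_matrix_vector: "bilinear ((*v) :: real^'n^'m \<Rightarrow> real^'n \<Rightarrow> real^'m)"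
  unfolding bilinear_def linear_iff
  by (intro conjI allI matrix_vector_right_distrib matrix_vector_mult_add_rdistrib
      scaleR_matrix_vector_assoc[symmetric] matrix_vector_mult_scaleR)

lemma admissible_mult_integrable:
  assumes "admissible T F" "f absolutely_integrable_on {0..T}"
  shows "(\<lambda>s. F s *v f s) absolutely_integrable_on {0..T}"
  by (rule absolutely_integrable_bounded_measurable_product[where h="(*v)" and f=F and g=f])
    (use assms in \<open>auto simp: admissible_def bilinear_matrix_vector\<close>)

lemma matrix_mult_integrable:
  fixes X :: "real^'n^'m"
  assumes "f absolutely_integrable_on S"
  shows "(\<lambda>s. X *v f s) absolutely_integrable_on S"
  using absolutely_integrable_linear[OF assms, of "(*v) X"] by (simp add: o_def)

lemma lin_sol_integrable:
  assumes "admissible T F" "f absolutely_integrable_on {0..T}" "continuous_on {0..T} x"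
  shows "(\<lambda>s. F s *v x s + f s) absolutely_integrable_on {0..T}"
  by (rule set_integral_add(1)[OF admissible_mult_integrable[OF assms(1)
        absolutely_integrable_continuous_real[OF assms(3)]] assms(2)])

lemma absolutely_integrable_subinterval:
  fixes f :: "real \<Rightarrow> 'a::euclidean_space"
  assumes "f absolutely_integrable_on {0..T}" "0 \<le> s" "t \<le> T"
  shows "f absolutely_integrable_on {s..t}"
  by (rule absolutely_integrable_on_subinterval[OF assms(1)]) (use assms in auto)

lemma lin_sol_subinterval:
  assumes "lin_sol T F f x0 x" "t \<le> T"
  shows "lin_sol t F f x0 x"
  using assms by (auto simp: lin_sol_def intro: continuous_on_subset)

text \<open>Changes at finitely many times are allowed because time reversal turns cells closed on the left
  into cells closed on the right.\<close>

lemma lin_sol_cong: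
  assumes "lin_sol T F f x0 x" "finite N"
    and "\<And>s. s \<in> {0..T} - N \<Longrightarrow> F s = G s \<and> f s = g s"
  shows "lin_sol T G g x0 x"
proof -
  have "integral {0..t} (\<lambda>s. F s *v x s + f s) = integral {0..t} (\<lambda>s. G s *v x s + g s)"
    if "t \<in> {0..T}" for t
    by (rule integral_spike[of N]) (use assms that in auto)
  with assms(1) show ?thesis by (auto simp: lin_sol_def)
qed

text \<open>Superposition for two different coefficients: the mismatch of the coefficients enters as a forcing.
  With \<open>F = G\<close> this is linearity, with \<open>c = -1\<close> it is the equation of an error.\<close>

lemma lin_sol_combine:
  assumes F: "admissible T F" and G: "admissible T G"
    and f: "f absolutely_integrable_on {0..T}" and g: "g absolutely_integrable_on {0..T}"
    and x: "lin_sol T F f x0 x" and y: "lin_sol T G g y0 y"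
  shows "lin_sol T F (\<lambda>s. f s + c *\<^sub>R (g s + (G s - F s) *v y s)) (x0 + c *\<^sub>R y0) (\<lambda>t. x t + c *\<^sub>R y t)"
  unfolding lin_sol_def
proof (intro conjI ballI)
  have cx: "continuous_on {0..T} x" and cy: "continuous_on {0..T} y"
    using x y by (auto simp: lin_sol_def)
  then show "continuous_on {0..T} (\<lambda>t. x t + c *\<^sub>R y t)" by (intro continuous_intros)
  fix t assume t: "t \<in> {0..T}"
  have 1: "(\<lambda>s. F s *v x s + f s) integrable_on {0..t}" "(\<lambda>s. G s *v y s + g s) integrable_on {0..t}"
    using absolutely_integrable_subinterval[OF lin_sol_integrable[OF F f cx], of 0 t]
      absolutely_integrable_subinterval[OF lin_sol_integrable[OF G g cy], of 0 t] t
    by (auto intro: set_lebesgue_integral_eq_integral(1))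
  have "x t + c *\<^sub>R y t = (x0 + c *\<^sub>R y0) + (integral {0..t} (\<lambda>s. F s *v x s + f s)
      + integral {0..t} (\<lambda>s. c *\<^sub>R (G s *v y s + g s)))"
    unfolding integral_cmul using x y t by (auto simp: lin_sol_def scaleR_add_right)
  also have "integral {0..t} (\<lambda>s. F s *v x s + f s) + integral {0..t} (\<lambda>s. c *\<^sub>R (G s *v y s + g s))
      = integral {0..t} (\<lambda>s. (F s *v x s + f s) + c *\<^sub>R (G s *v y s + g s))"
    by (rule Henstock_Kurzweil_Integration.integral_add[symmetric]) (use 1 in \<open>auto intro: integrable_cmul\<close>)
  also have "(\<lambda>s. (F s *v x s + f s) + c *\<^sub>R (G s *v y s + g s)) =
      (\<lambda>s. F s *v (x s + c *\<^sub>R y s) + (f s + c *\<^sub>R (g s + (G s - F s) *v y s)))"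
    by (simp add: algebra_simps matrix_vector_right_distrib matrix_vector_mult_diff_rdistrib
        matrix_vector_mult_scaleR)
  finally show "x t + c *\<^sub>R y t = x0 + c *\<^sub>R y0 + integral {0..t}
      (\<lambda>s. F s *v (x s + c *\<^sub>R y s) + (f s + c *\<^sub>R (g s + (G s - F s) *v y s)))" .
qed

text \<open>Twice the pairing of the state with its derivative is the derivative of the squared norm, and the coefficient contributes to it with a
  favourable sign. The bound does not see the size of \<open>F\<close>, which is what makes it uniform in the
  splitting.\<close>

lemma energy_inequality:
  assumes F: "admissible T F" and f: "f absolutely_integrable_on {0..T}"
    and x: "lin_sol T F f x0 x" and diss: "\<And>s. s \<in> {0..T} \<Longrightarrow> dissipative (F s)"
    and t: "t \<in> {0..T}"
  shows "(norm (x t))\<^sup>2 \<le> (norm x0)\<^sup>2 + 2 * integral {0..t} (\<lambda>s. x s \<bullet> f s)"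
proof -
  have cx: "continuous_on {0..t} x"
    using x t by (auto simp: lin_sol_def intro: continuous_on_subset)
  have a: "(\<lambda>s. F s *v x s + f s) absolutely_integrable_on {0..t}"
    using t by (intro lin_sol_integrable cx admissible_subinterval[OF F]
        absolutely_integrable_subinterval[OF f]) auto
  have xe: "x s = x0 + integral {0..s} (\<lambda>s. F s *v x s + f s)" if "s \<in> {0..t}" for s
    using x t that by (auto simp: lin_sol_def)
  have "(norm (x t))\<^sup>2 = (norm x0)\<^sup>2 + integral {0..t} (\<lambda>s. (F s *v x s + f s) \<bullet> x s + x s \<bullet> (F s *v x s + f s))"
    using absolutely_continuous_product_rule[OF _ a a xe xe] t by (simp add: power2_norm_eq_inner)
  also have "integral {0..t} (\<lambda>s. (F s *v x s + f s) \<bullet> x s + x s \<bullet> (F s *v x s + f s))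
      \<le> integral {0..t} (\<lambda>s. 2 * (x s \<bullet> f s))"
  proof (rule integral_le)
    show "(\<lambda>s. (F s *v x s + f s) \<bullet> x s + x s \<bullet> (F s *v x s + f s)) integrable_on {0..t}"
      using set_lebesgue_integral_eq_integral(1)[OF integrable_inner_continuous[OF a cx]]
      by (auto simp: inner_commute intro: integrable_add)
    have "(\<lambda>s. f s \<bullet> x s) integrable_on {0..t}"
      using t by (intro set_lebesgue_integral_eq_integral(1) integrable_inner_continuous cx
          absolutely_integrable_subinterval[OF f]) auto
    then show "(\<lambda>s. 2 * (x s \<bullet> f s)) integrable_on {0..t}"
      by (auto simp: inner_commute intro: integrable_on_mult_right)
    fix s assume "s \<in> {0..t}"
    then have "x s \<bullet> (F s *v x s) \<le> 0" using diss[of s] t by (auto simp: dissipative_def)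
    then show "(F s *v x s + f s) \<bullet> x s + x s \<bullet> (F s *v x s + f s) \<le> 2 * (x s \<bullet> f s)"
      by (simp add: inner_add_right inner_commute)
  qed
  finally show ?thesis by simp
qed

lemma dissipative_bound:
  assumes F: "admissible T F" and f: "f absolutely_integrable_on {0..T}"
    and x: "lin_sol T F f x0 x" and diss: "\<And>s. s \<in> {0..T} \<Longrightarrow> dissipative (F s)"
    and t: "t \<in> {0..T}"
  shows "norm (x t) \<le> norm x0 + 2 * integral {0..T} (\<lambda>s. norm (f s))"
proof -
  have cx: "continuous_on {0..T} (\<lambda>t. norm (x t))"
    using x by (auto simp: lin_sol_def intro: continuous_on_norm)
  \<comment> \<open>At a time of maximal norm the energy inequality is linear in that norm.\<close>
  obtain r where r: "r \<in> {0..T}" and max: "\<And>s. s \<in> {0..T} \<Longrightarrow> norm (x s) \<le> norm (x r)"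
    using continuous_attains_sup[OF _ _ cx] t by (metis compact_Icc empty_iff)
  let ?m = "norm (x r)" and ?I = "integral {0..T} (\<lambda>s. norm (f s))"
  have fa: "(\<lambda>s. norm (f s)) absolutely_integrable_on {0..T}" using f by (rule absolutely_integrable_norm[unfolded o_def])
  then have fi: "(\<lambda>s. norm (f s)) integrable_on {0..T}"
    by (rule set_lebesgue_integral_eq_integral(1))
  have fir: "(\<lambda>s. norm (f s)) integrable_on {0..r}"
    by (rule integrable_on_subinterval[OF fi]) (use r in auto)
  have cxr: "continuous_on {0..r} x" using x r by (auto simp: lin_sol_def intro: continuous_on_subset)
  have "integral {0..r} (\<lambda>s. x s \<bullet> f s) \<le> integral {0..r} (\<lambda>s. ?m * norm (f s))"
  proof (rule integral_le)
    have "(\<lambda>s. f s \<bullet> x s) integrable_on {0..r}"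
      using r by (intro set_lebesgue_integral_eq_integral(1) integrable_inner_continuous cxr
          absolutely_integrable_subinterval[OF f]) auto
    then show "(\<lambda>s. x s \<bullet> f s) integrable_on {0..r}" by (simp add: inner_commute)
    show "(\<lambda>s. ?m * norm (f s)) integrable_on {0..r}" using fir by (intro integrable_on_mult_right)
    fix s assume "s \<in> {0..r}"
    then show "x s \<bullet> f s \<le> ?m * norm (f s)"
      using max[of s] r by (intro order_trans[OF norm_cauchy_schwarz] mult_right_mono) auto
  qed
  also have "\<dots> = ?m * integral {0..r} (\<lambda>s. norm (f s))" by simp
  also have "\<dots> \<le> ?m * ?I"
    by (intro mult_left_mono integral_subset_le fi fir) (use r in auto)
  finally have "?m\<^sup>2 \<le> (norm x0)\<^sup>2 + 2 * (?m * ?I)"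
    using energy_inequality[OF F f x diss r] by simp
  moreover have "norm x0 \<le> ?m"
  proof -
    have "x 0 = x0" using x t by (simp add: lin_sol_def)
    then show ?thesis using max[of 0] t by auto
  qed
  then have "(norm x0)\<^sup>2 \<le> norm x0 * ?m" by (simp add: power2_eq_square mult_left_mono)
  ultimately have "?m * ?m \<le> (norm x0 + 2 * ?I) * ?m" by (simp add: power2_eq_square algebra_simps)
  moreover have "0 \<le> ?I" by (rule Henstock_Kurzweil_Integration.integral_nonneg[OF fi]) simp
  ultimately have "?m \<le> norm x0 + 2 * ?I"
    by (cases "?m = 0") (auto simp: mult_le_cancel_right)
  then show ?thesis using max[OF t] by simp
qed

lemma lin_sol_unique:
  assumes F: "admissible T F" and f: "f absolutely_integrable_on {0..T}"
    and x: "lin_sol T F f x0 x" and y: "lin_sol T F f x0 y"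
    and diss: "\<And>s. s \<in> {0..T} \<Longrightarrow> dissipative (F s)" and t: "t \<in> {0..T}"
  shows "x t = y t"
proof -
  have "lin_sol T F (\<lambda>s. 0) 0 (\<lambda>t. x t - y t)"
    using lin_sol_combine[OF F F f f x y, of "-1"] by simp
  from dissipative_bound[OF F _ this diss t] show ?thesis by simp
qed

lemma exp_integral:
  assumes "0 < m" "0 \<le> t"
  shows "((\<lambda>s. exp (m * s)) has_integral (exp (m * t) - 1) / m) {0..t::real}"
proof -
  have "((\<lambda>s. exp (m * s)) has_integral (exp (m * t) / m - exp (m * 0) / m)) {0..t}"
    by (rule fundamental_theorem_of_calculus)
      (use assms in \<open>auto intro!: derivative_eq_intros simp: has_real_derivative_iff_has_vector_derivative[symmetric]\<close>)
  then show ?thesis by (simp add: diff_divide_distrib)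
qed

text \<open>Banach's fixed point theorem for the rescaled unknown \<open>w(t) = exp(-m t) x(t)\<close>. For \<open>m\<close> twice a bound of the
  coefficient the weight makes the integral operator a contraction with factor 1/2 on the
  whole interval. Functions on \<open>[0, T]\<close> are represented on the line by clamping the time.\<close>

lemma lin_sol_exists:
  fixes F :: "real \<Rightarrow> real^'n^'n"
  assumes T: "0 \<le> T" and F: "admissible T F" and f: "f absolutely_integrable_on {0..T}"
  shows "\<exists>x. lin_sol T F f x0 x"
proof -
  obtain b where b: "b > 0" "\<And>(X::real^'n^'n) v. norm (X *v v) \<le> b * norm X * norm v"
    using bilinear_bounded_pos[OF bilinear_matrix_vector] by blast
  obtain c where c: "c > 0" "\<And>s. s \<in> {0..T} \<Longrightarrow> norm (F s) \<le> c"
    using F unfolding admissible_def bounded_pos by auto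
  define L where "L = b * c"
  have L: "L > 0" "\<And>s v. s \<in> {0..T} \<Longrightarrow> norm (F s *v v) \<le> L * norm v"
  proof -
    fix s :: real and v :: "real^'n" assume "s \<in> {0..T}"
    then have "b * norm (F s) * norm v \<le> L * norm v"
      unfolding L_def using b c by (intro mult_right_mono mult_left_mono) auto
    with b(2)[of "F s" v] show "norm (F s *v v) \<le> L * norm v" by linarith
  qed (use b c in \<open>auto simp: L_def\<close>)
  define m where "m = 2 * L"
  have m: "m > 0" using L by (simp add: m_def)
  define cl where "cl = (\<lambda>t::real. max 0 (min T t))"
  have cl: "cl t \<in> {0..T}" "t \<in> {0..T} \<Longrightarrow> cl t = t" for t using T by (auto simp: cl_def)
  have ccl: "continuous_on UNIV cl" unfolding cl_def by (intro continuous_intros)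
  define g where "g = (\<lambda>w s. F s *v (exp (m * s) *\<^sub>R w s) + f s)"
  define Phi where "Phi = (\<lambda>w t. exp (- m * t) *\<^sub>R (x0 + integral {0..t} (g w)))"
  have gi: "g (apply_bcontfun w) integrable_on {0..T}" for w
    unfolding g_def
    by (intro set_lebesgue_integral_eq_integral(1) lin_sol_integrable F f continuous_intros) auto
  have cPhi: "continuous_on {0..T} (Phi (apply_bcontfun w))" for w
    unfolding Phi_def by (intro continuous_intros indefinite_integral_continuous_1 gi)
  have bc: "(\<lambda>t. Phi (apply_bcontfun w) (cl t)) \<in> bcontfun" for w
  proof -
    have "bounded (Phi (apply_bcontfun w) ` {0..T})"
      using cPhi by (simp add: compact_continuous_image compact_imp_bounded)
    then have "bounded (range (\<lambda>t. Phi (apply_bcontfun w) (cl t)))"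
      by (rule bounded_subset) (use cl in auto)
    moreover have "continuous_on UNIV (\<lambda>t. Phi (apply_bcontfun w) (cl t))"
      by (rule continuous_on_compose2[OF cPhi ccl]) (use cl in auto)
    ultimately show ?thesis by (simp add: bcontfun_def)
  qed
  define Psi where "Psi = (\<lambda>w. Bcontfun (\<lambda>t. Phi (apply_bcontfun w) (cl t)))"
  have Psi: "apply_bcontfun (Psi w) t = Phi (apply_bcontfun w) (cl t)" for w t
    unfolding Psi_def using bc[of w] by (simp add: Bcontfun_inverse)
  have lip: "dist (Psi v) (Psi w) \<le> 1/2 * dist v w" for v w
  proof (rule dist_bound)
    fix t
    define r where "r = cl t"
    have r: "0 \<le> r" "r \<le> T" using cl(1)[of t] by (auto simp: r_def)
    have gir: "g (apply_bcontfun w) integrable_on {0..r}" for w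
      by (rule integrable_on_subinterval[OF gi]) (use r in auto)
    have "norm (integral {0..r} (\<lambda>s. g (apply_bcontfun v) s - g (apply_bcontfun w) s))
        \<le> integral {0..r} (\<lambda>s. L * dist v w * exp (m * s))"
    proof (rule integral_norm_bound_integral)
      show "(\<lambda>s. g (apply_bcontfun v) s - g (apply_bcontfun w) s) integrable_on {0..r}"
        by (intro integrable_diff gir)
      show "(\<lambda>s. L * dist v w * exp (m * s)) integrable_on {0..r}"
        using exp_integral[OF m r(1)] by (intro integrable_on_mult_right) auto
      fix s assume s: "s \<in> {0..r}"
      have "g (apply_bcontfun v) s - g (apply_bcontfun w) s
          = F s *v (exp (m * s) *\<^sub>R (apply_bcontfun v s - apply_bcontfun w s))"
        by (simp add: g_def matrix_vector_mult_diff_distrib scaleR_diff_right)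
      also have "norm \<dots> \<le> L * (exp (m * s) * dist (apply_bcontfun v s) (apply_bcontfun w s))"
        using L(2)[of s] s r by (simp add: dist_norm) (metis abs_exp_cancel norm_scaleR)
      also have "\<dots> \<le> L * (exp (m * s) * dist v w)"
        using L(1) by (intro mult_left_mono dist_bounded) auto
      finally show "norm (g (apply_bcontfun v) s - g (apply_bcontfun w) s) \<le> L * dist v w * exp (m * s)"
        by (simp add: mult_ac)
    qed
    also have "\<dots> = L * dist v w * ((exp (m * r) - 1) / m)"
      using exp_integral[OF m r(1)] by (simp add: integral_unique)
    also have "\<dots> = dist v w * (exp (m * r) - 1) / 2" using L by (simp add: m_def)
    finally have *: "norm (integral {0..r} (g (apply_bcontfun v)) - integral {0..r} (g (apply_bcontfun w)))
        \<le> dist v w * (exp (m * r) - 1) / 2"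
      using Henstock_Kurzweil_Integration.integral_diff[OF gir gir, of v w] by simp
    have "dist (apply_bcontfun (Psi v) t) (apply_bcontfun (Psi w) t)
        = exp (- m * r) * norm (integral {0..r} (g (apply_bcontfun v)) - integral {0..r} (g (apply_bcontfun w)))"
      by (simp add: Psi r_def[symmetric] Phi_def dist_norm scaleR_diff_right[symmetric])
    also have "\<dots> \<le> exp (- m * r) * (dist v w * (exp (m * r) - 1) / 2)"
      by (intro mult_left_mono *) simp
    also have "\<dots> = 1/2 * dist v w * (1 - exp (- m * r))"
      by (simp add: algebra_simps exp_minus)
    also have "\<dots> \<le> 1/2 * dist v w * 1" by (intro mult_left_mono) auto
    finally show "dist (apply_bcontfun (Psi v) t) (apply_bcontfun (Psi w) t) \<le> 1/2 * dist v w" by simp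
  qed
  obtain w where w: "Psi w = w"
    using banach_fix_type[of "1/2" Psi] lip by auto
  define x where "x = (\<lambda>t. exp (m * t) *\<^sub>R apply_bcontfun w t)"
  have "x t = x0 + integral {0..t} (\<lambda>s. F s *v x s + f s)" if "t \<in> {0..T}" for t
  proof -
    have "apply_bcontfun w t = Phi (apply_bcontfun w) t" using Psi[of w t] w cl(2)[OF that] by simp
    then have "x t = (exp (m * t) * exp (- m * t)) *\<^sub>R (x0 + integral {0..t} (g (apply_bcontfun w)))"
      by (simp add: x_def Phi_def)
    then show ?thesis by (simp add: exp_add[symmetric] g_def x_def)
  qed
  moreover have "continuous_on {0..T} x" unfolding x_def by (intro continuous_intros) auto
  ultimately show ?thesis by (auto simp: lin_sol_def)
qed

section \<open>Dissipative matrices\<close>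

lemma sum_matrix_vector: "(\<Sum>i\<in>I. X i) *v v = (\<Sum>i\<in>I. X i *v v)"
  for X :: "'i \<Rightarrow> real^'n^'m"
  by (induction I rule: infinite_finite_induct) (simp_all add: matrix_vector_mult_add_rdistrib)

lemma dissipative_0: "dissipative 0"
  by (simp add: dissipative_def)

lemma dissipative_scaleR: "dissipative X \<Longrightarrow> 0 \<le> c \<Longrightarrow> dissipative (c *\<^sub>R X)"
  by (simp add: dissipative_def scaleR_matrix_vector_assoc[symmetric] mult_nonneg_nonpos)

lemma dissipative_sum: "(\<And>i. i \<in> I \<Longrightarrow> dissipative (X i)) \<Longrightarrow> dissipative (\<Sum>i\<in>I. X i)"
  by (simp add: dissipative_def sum_matrix_vector inner_sum_right sum_nonpos)

lemma dissipative_transpose: "dissipative X \<Longrightarrow> dissipative (transpose X)"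
  unfolding dissipative_def by (metis inner_commute inner_transpose_mult)

section \<open>Finitely many independent samples\<close>

definition weight :: "nat \<Rightarrow> (nat \<Rightarrow> real) \<Rightarrow> (nat \<Rightarrow> nat) \<Rightarrow> real" where
  "weight K p w = (\<Prod>k=1..K. p (w k))"

locale sampling =
  fixes M K :: nat and p :: "nat \<Rightarrow> real"
  assumes p_nonneg: "\<And>i. i \<in> {1..2^M} \<Longrightarrow> 0 \<le> p i" and p_sum: "(\<Sum>i=1..2^M. p i) = 1"
begin

abbreviation E where "E \<equiv> expect M K p"

lemma expect_alt: "E X = (\<Sum>w\<in>Omega_K M K. X w * weight K p w)"
  by (simp add: expect_def weight_def)

lemma finite_Omega_K: "finite (Omega_K M K)"
  by (simp add: Omega_K_def finite_PiE)

lemma Omega_K_app: "w \<in> Omega_K M K \<Longrightarrow> k \<in> {1..K} \<Longrightarrow> w k \<in> {1..2^M}"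
  unfolding Omega_K_def by (rule PiE_mem)

lemma Omega_K_upd: "w \<in> Omega_K M K \<Longrightarrow> k \<in> {1..K} \<Longrightarrow> i \<in> {1..2^M} \<Longrightarrow> w(k := i) \<in> Omega_K M K"
  unfolding Omega_K_def by (auto simp: PiE_iff extensional_def)

lemma weight_nonneg: "w \<in> Omega_K M K \<Longrightarrow> 0 \<le> weight K p w"
  unfolding weight_def by (intro prod_nonneg p_nonneg Omega_K_app) auto

lemma expect_mono:
  "(\<And>w. w \<in> Omega_K M K \<Longrightarrow> X w \<le> Y w) \<Longrightarrow> E X \<le> E Y"
  unfolding expect_alt by (intro sum_mono mult_right_mono weight_nonneg) auto

lemma expect_cong:
  "(\<And>w. w \<in> Omega_K M K \<Longrightarrow> X w = Y w) \<Longrightarrow> E X = E Y"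
  unfolding expect_alt by (intro sum.cong) auto

lemma expect_add: "E (\<lambda>w. X w + Y w) = E X + E Y"
  by (simp add: expect_alt distrib_right sum.distrib)

lemma expect_cmult: "E (\<lambda>w. c * X w) = c * E X"
  by (simp add: expect_alt sum_distrib_left mult.assoc)

lemma expect_const: "E (\<lambda>w. c) = c"
proof -
  have "(\<Sum>w\<in>Omega_K M K. weight K p w) = (\<Prod>k\<in>{1..K}. \<Sum>i\<in>{1..2^M}. p i)"
    unfolding Omega_K_def weight_def by (rule prod_sum_PiE[symmetric]) auto
  then have "(\<Sum>w\<in>Omega_K M K. weight K p w) = 1" unfolding p_sum by simp
  then show ?thesis by (simp add: expect_alt sum_distrib_left[symmetric])
qed

lemma expect_nonneg: "(\<And>w. w \<in> Omega_K M K \<Longrightarrow> 0 \<le> X w) \<Longrightarrow> 0 \<le> E X"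
  using expect_mono[of "\<lambda>_. 0" X] expect_const[of 0] by simp

text \<open>Independence of one coordinate: the map that exchanges coordinate \<open>k\<close> of a tuple with an extra sample \<open>i\<close>
  is an involution that preserves the product weight, so \<open>w k\<close> may be replaced by an independent
  copy wherever \<open>w k\<close> does not enter through the second argument of \<open>Y\<close>.\<close>

lemma expect_resample:
  assumes k: "k \<in> {1..K}"
    and indep: "\<And>w i j. w \<in> Omega_K M K \<Longrightarrow> i \<in> {1..2^M} \<Longrightarrow> j \<in> {1..2^M} \<Longrightarrow>
      Y i (w(k := j)) = Y i w"
  shows "E (\<lambda>w. Y (w k) w) = (\<Sum>i=1..2^M. p i * E (Y i))"
proof -
  have swap: "weight K p (w(k := i)) * p (w k) = weight K p w * p i" for w i
  proof -
    have "weight K p w = p (w k) * (\<Prod>l\<in>{1..K} - {k}. p (w l))" for w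
      unfolding weight_def by (rule prod.remove) (use k in auto)
    moreover have "(\<Prod>l\<in>{1..K} - {k}. p ((w(k := i)) l)) = (\<Prod>l\<in>{1..K} - {k}. p (w l))"
      by (rule prod.cong) auto
    ultimately show ?thesis by (simp add: mult_ac)
  qed
  have "E (\<lambda>w. Y (w k) w) = E (\<lambda>w. Y (w k) w) * (\<Sum>i=1..2^M. p i)" unfolding p_sum by simp
  also have "\<dots> = (\<Sum>(w, i)\<in>Omega_K M K \<times> {1..2^M}. Y (w k) w * weight K p w * p i)"
    by (simp add: expect_alt sum_product sum.cartesian_product)
  also have "\<dots> = (\<Sum>(w, i)\<in>Omega_K M K \<times> {1..2^M}. Y i w * weight K p w * p i)"
  proof (rule sum.reindex_bij_witness[where i="\<lambda>(w, i). (w(k := i), w k)" and j="\<lambda>(w, i). (w(k := i), w k)"])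
    fix a assume a: "a \<in> Omega_K M K \<times> {1..(2::nat)^M}"
    obtain w i where ai: "a = (w, i)" "w \<in> Omega_K M K" "i \<in> {1..2^M}" using a by auto
    have "Y (w k) (w(k := i)) * weight K p (w(k := i)) * p (w k) = Y (w k) w * weight K p w * p i"
      using swap[of w i] indep[of w "w k" i] ai Omega_K_app[of w k] k by simp
    then show "(case case a of (w, i) \<Rightarrow> (w(k := i), w k) of (w, i) \<Rightarrow> Y i w * weight K p w * p i)
        = (case a of (w, i) \<Rightarrow> Y (w k) w * weight K p w * p i)"
      by (simp add: ai)
  qed (use k Omega_K_app Omega_K_upd in \<open>auto split: prod.splits\<close>)
  also have "\<dots> = (\<Sum>i=1..2^M. p i * E (Y i))"
    by (simp add: expect_alt sum_distrib_left sum.cartesian_product[symmetric] mult_ac)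
      (rule sum.swap)
  finally show ?thesis .
qed

text \<open>Jensen's inequality for the square, from the nonnegative variance.\<close>

lemma expect_sq_le: "(E X)\<^sup>2 \<le> E (\<lambda>w. (X w)\<^sup>2)"
proof -
  define m where "m = E X"
  have "0 \<le> E (\<lambda>w. (X w - m)\<^sup>2)" by (rule expect_nonneg) simp
  also have "E (\<lambda>w. (X w - m)\<^sup>2) = E (\<lambda>w. (X w)\<^sup>2 + ((- 2 * m) * X w + m\<^sup>2))"
    by (rule expect_cong) (simp add: power2_diff)
  also have "\<dots> = E (\<lambda>w. (X w)\<^sup>2) - m\<^sup>2"
    unfolding expect_add expect_cmult expect_const by (simp add: m_def[symmetric] power2_eq_square)
  finally show ?thesis by (simp add: m_def)
qed

lemma
  fixes g :: "(nat \<Rightarrow> nat) \<Rightarrow> real \<Rightarrow> real"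
  assumes "\<And>w. w \<in> Omega_K M K \<Longrightarrow> g w integrable_on S"
  shows expect_integrable: "(\<lambda>s. E (\<lambda>w. g w s)) integrable_on S"
    and expect_integral: "integral S (\<lambda>s. E (\<lambda>w. g w s)) = E (\<lambda>w. integral S (g w))"
proof -
  have *: "(\<lambda>s. g w s * weight K p w) integrable_on S" if "w \<in> Omega_K M K" for w
    using assms[OF that] by (rule integrable_on_mult_left)
  show "(\<lambda>s. E (\<lambda>w. g w s)) integrable_on S"
    unfolding expect_alt by (intro integrable_sum finite_Omega_K *)
  show "integral S (\<lambda>s. E (\<lambda>w. g w s)) = E (\<lambda>w. integral S (g w))"
    unfolding expect_alt by (subst integral_sum[OF finite_Omega_K *]) auto
qed

end

section \<open>Step functions on a grid\<close>

definition step_fun :: "(nat \<Rightarrow> real) \<Rightarrow> nat \<Rightarrow> (nat \<Rightarrow> 'a) \<Rightarrow> real \<Rightarrow> 'a::comm_monoid_add" where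
  "step_fun \<tau> K G t = (\<Sum>k=1..K. if t \<in> {\<tau> (k-1)..<\<tau> k} then G k else 0)"

lemma admissible_step_fun: "admissible T (step_fun \<tau> K G)"
  unfolding admissible_def
proof
  have "(\<lambda>t. if t \<in> {\<tau> (k-1)..<\<tau> k} then G k else 0) \<in> borel_measurable (lebesgue_on {0..T})" for k
    by (intro measurable_restrict_space1 measurable_completion) simp
  then show "step_fun \<tau> K G \<in> borel_measurable (lebesgue_on {0..T})"
    unfolding step_fun_def[abs_def] by (intro borel_measurable_sum)
  have "norm (step_fun \<tau> K G t) \<le> (\<Sum>k=1..K. norm (G k))" for t
    unfolding step_fun_def by (rule sum_norm_le) auto
  then show "bounded (step_fun \<tau> K G ` {0..T})" by (auto intro: boundedI)
qed

lemma dissipative_step_fun: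
  "(\<And>k. k \<in> {1..K} \<Longrightarrow> dissipative (G k)) \<Longrightarrow> dissipative (step_fun \<tau> K G t)"
  unfolding step_fun_def by (intro dissipative_sum) (auto simp: dissipative_0)

locale grid =
  fixes T :: real and K :: nat and \<tau> :: "nat \<Rightarrow> real" and h :: real
  assumes grid_0: "\<tau> 0 = 0" and grid_K: "\<tau> K = T"
    and grid_less: "\<And>k. k \<in> {1..K} \<Longrightarrow> \<tau> (k-1) < \<tau> k"
    and grid_spacing: "\<And>k. k \<in> {1..K} \<Longrightarrow> \<tau> k - \<tau> (k-1) \<le> h"
begin

lemma grid_mono: "j \<le> k \<Longrightarrow> k \<le> K \<Longrightarrow> \<tau> j \<le> \<tau> k"
proof (induction k)
  case (Suc k)
  then show ?case using grid_less[of "Suc k"] by (cases "j = Suc k") auto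
qed simp

lemma grid_bounds: "k \<le> K \<Longrightarrow> 0 \<le> \<tau> k \<and> \<tau> k \<le> T"
  using grid_mono[of 0 k] grid_mono[of k K] grid_0 grid_K by auto

lemma grid_cell:
  assumes "0 \<le> t" "t < T"
  obtains k where "k \<in> {1..K}" "\<tau> (k-1) \<le> t" "t < \<tau> k"
proof -
  define k where "k = (LEAST k. t < \<tau> k)"
  have "t < \<tau> K" using assms grid_K by simp
  then have k: "t < \<tau> k" "k \<le> K" unfolding k_def by (auto intro: LeastI Least_le)
  have "k \<noteq> 0" using k assms grid_0 by (cases k) auto
  moreover have "\<not> t < \<tau> (k-1)" using not_less_Least[of "k-1" "\<lambda>k. t < \<tau> k"] \<open>k \<noteq> 0\<close> by (simp add: k_def)
  ultimately show ?thesis using k that[of k] by auto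
qed

lemma step_fun_cell:
  assumes k: "k \<in> {1..K}" and t: "\<tau> (k-1) \<le> t" "t < \<tau> k"
  shows "step_fun \<tau> K G t = G k"
proof -
  have uniq: "l = k" if "l \<in> {1..K}" "\<tau> (l-1) \<le> t" "t < \<tau> l" for l
  proof (rule ccontr)
    assume "l \<noteq> k"
    then have "l \<le> k - 1 \<and> k - 1 \<le> K \<or> k \<le> l - 1 \<and> l - 1 \<le> K" using that(1) k by auto
    then have "\<tau> l \<le> \<tau> (k-1) \<or> \<tau> k \<le> \<tau> (l-1)" using grid_mono[of l "k-1"] grid_mono[of k "l-1"] by blast
    then show False using that(2,3) t by (meson leD le_less_trans order_trans)
  qed
  have "(if t \<in> {\<tau> (l-1)..<\<tau> l} then G l else 0) = (if l = k then G l else 0)" if "l \<in> {1..K}" for l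
    using uniq[OF that] t by (cases "l = k") (simp_all del: One_nat_def, blast)
  then have "step_fun \<tau> K G t = (\<Sum>l=1..K. if l = k then G l else 0)"
    unfolding step_fun_def by (rule sum.cong[OF refl])
  then show ?thesis using k by simp
qed

end

section \<open>Mean square error of the randomly split system\<close>

text \<open>The cell with number \<open>k\<close> uses the sample with number \<open>\<kappa> k\<close>. The identity gives the split system; the
  reversal of the order, together with transposed matrices, gives its adjoint, so the error
  estimate is needed only once.\<close>

locale random_system = sampling M K p + grid T K \<tau> h
  for M K :: nat and p :: "nat \<Rightarrow> real" and T :: real and \<tau> :: "nat \<Rightarrow> real" and h :: real +
  fixes L :: "nat \<Rightarrow> real^'n^'n" and A :: "real^'n^'n" and \<kappa> :: "nat \<Rightarrow> nat" and V :: real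
  assumes T_pos: "0 < T"
    and mean: "\<And>v. (\<Sum>i=1..2^M. p i *\<^sub>R (L i *v v)) = A *v v"
    and L_diss: "\<And>i. i \<in> {1..2^M} \<Longrightarrow> dissipative (L i)" and A_diss: "dissipative A"
    and variance: "(\<Sum>i=1..2^M. p i * (opnorm (L i - A))\<^sup>2) = V"
    and \<kappa>: "\<And>k. k \<in> {1..K} \<Longrightarrow> \<kappa> k \<in> {1..K}" "inj_on \<kappa> {1..K}"
begin

definition F :: "(nat \<Rightarrow> nat) \<Rightarrow> real \<Rightarrow> real^'n^'n" where
  "F w = step_fun \<tau> K (\<lambda>k. L (w (\<kappa> k)))"

lemma F_admissible: "admissible T (F w)"
  unfolding F_def by (rule admissible_step_fun)

lemma F_diss: "w \<in> Omega_K M K \<Longrightarrow> dissipative (F w t)"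
  unfolding F_def by (intro dissipative_step_fun L_diss Omega_K_app \<kappa>)

lemma F_cell: "k \<in> {1..K} \<Longrightarrow> \<tau> (k-1) \<le> t \<Longrightarrow> t < \<tau> k \<Longrightarrow> F w t = L (w (\<kappa> k))"
  unfolding F_def by (rule step_fun_cell)

lemma F_past:
  assumes k: "k \<in> {1..K}" and t: "t < \<tau> (k-1)"
  shows "F (w(\<kappa> k := j)) t = F w t"
  unfolding F_def step_fun_def
proof (rule sum.cong[OF refl])
  fix l assume l: "l \<in> {1..K}"
  have "\<not> \<tau> (l-1) \<le> t" if "l = k" using t that by simp
  moreover have "\<kappa> l \<noteq> \<kappa> k" if "l \<noteq> k" using \<kappa>(2) l k that by (auto dest: inj_onD)
  ultimately show "(if t \<in> {\<tau> (l-1)..<\<tau> l} then L ((w(\<kappa> k := j)) (\<kappa> l)) else 0)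
      = (if t \<in> {\<tau> (l-1)..<\<tau> l} then L (w (\<kappa> l)) else 0)"
    by (cases "l = k") (simp_all del: One_nat_def)
qed

lemma expect_deviation: "k \<in> {1..K} \<Longrightarrow> E (\<lambda>w. (opnorm (L (w (\<kappa> k)) - A))\<^sup>2) = V"
  using expect_resample[OF \<kappa>(1), of k "\<lambda>i w. (opnorm (L i - A))\<^sup>2"] variance
  by (simp add: expect_const)

context
  fixes f x x0 xh X
  assumes f: "f absolutely_integrable_on {0..T}"
    and x: "lin_sol T (\<lambda>t. A) f x0 x"
    and xh: "\<And>w. w \<in> Omega_K M K \<Longrightarrow> lin_sol T (F w) f x0 (xh w)"
    and X: "norm x0 + 2 * integral {0..T} (\<lambda>s. norm (f s)) \<le> X"
begin

abbreviation err where "err w t \<equiv> xh w t - x t"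
abbreviation force where "force w t \<equiv> (F w t - A) *v x t"

lemma x_cont: "continuous_on {0..T} x" and xh_cont: "w \<in> Omega_K M K \<Longrightarrow> continuous_on {0..T} (xh w)"
  using x xh by (auto simp: lin_sol_def)

lemma x_bound: "t \<in> {0..T} \<Longrightarrow> norm (x t) \<le> X"
  using dissipative_bound[OF admissible_const f x] A_diss X by fastforce

lemma xh_bound: "w \<in> Omega_K M K \<Longrightarrow> t \<in> {0..T} \<Longrightarrow> norm (xh w t) \<le> X"
  using dissipative_bound[OF F_admissible f xh F_diss] X by fastforce

lemma X_nonneg: "0 \<le> X"
  using order_trans[OF norm_ge_zero x_bound[of 0]] T_pos by simp

lemma force_integrable: "force w absolutely_integrable_on {0..T}"
proof -
  have "x absolutely_integrable_on {0..T}" by (rule absolutely_integrable_continuous_real[OF x_cont])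
  then show ?thesis
    unfolding matrix_vector_mult_diff_rdistrib
    by (intro set_integral_diff(1) admissible_mult_integrable F_admissible admissible_const)
qed

lemma err_sol:
  assumes w: "w \<in> Omega_K M K"
  shows "lin_sol T (F w) (force w) 0 (err w)"
proof -
  have "lin_sol T (F w) (\<lambda>s. f s + (-1) *\<^sub>R (f s + (A - F w s) *v x s)) (x0 + (-1) *\<^sub>R x0) (\<lambda>t. xh w t + (-1) *\<^sub>R x t)"
    by (rule lin_sol_combine[OF F_admissible admissible_const f f xh[OF w] x])
  moreover have "f s + (-1) *\<^sub>R (f s + (A - F w s) *v x s) = force w s" for s
    by (simp add: algebra_simps)
  ultimately show ?thesis by simp
qed

lemma err_cont: "w \<in> Omega_K M K \<Longrightarrow> continuous_on {0..T} (err w)"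
  by (intro continuous_intros xh_cont x_cont)

text \<open>Up to the start of cell \<open>k\<close> only samples of earlier cells were used, so the sample of cell
  \<open>k\<close> cannot be felt there.\<close>

lemma err_past:
  assumes w: "w \<in> Omega_K M K" and k: "k \<in> {1..K}" and j: "j \<in> {1..2^M}"
  shows "xh (w(\<kappa> k := j)) (\<tau> (k-1)) = xh w (\<tau> (k-1))"
proof -
  let ?t = "\<tau> (k-1)" and ?w = "w(\<kappa> k := j)"
  have t: "0 \<le> ?t" "?t \<le> T" using grid_bounds[of "k-1"] k by auto
  have w': "?w \<in> Omega_K M K" by (intro Omega_K_upd w j \<kappa>(1) k)
  have "lin_sol ?t (F ?w) f x0 (xh ?w)" by (rule lin_sol_subinterval[OF xh[OF w'] t(2)])
  then have *: "lin_sol ?t (F w) f x0 (xh ?w)"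
    by (rule lin_sol_cong[where N="{?t}"]) (use F_past[OF k] in auto)
  show ?thesis
    by (rule lin_sol_unique[OF admissible_subinterval[OF F_admissible t(2)]
          absolutely_integrable_subinterval[OF f _ t(2)] * lin_sol_subinterval[OF xh[OF w] t(2)]])
      (use t F_diss[OF w] in auto)
qed

text \<open>The error at the start of a cell is independent of the sample in use, and \<open>L\<close> has mean \<open>A\<close>.\<close>

lemma expect_past_force:
  assumes k: "k \<in> {1..K}"
  shows "E (\<lambda>w. err w (\<tau> (k-1)) \<bullet> ((L (w (\<kappa> k)) - A) *v v)) = 0"
proof -
  let ?e = "\<lambda>w. err w (\<tau> (k-1))"
  have "E (\<lambda>w. ?e w \<bullet> ((L (w (\<kappa> k)) - A) *v v)) = (\<Sum>i=1..2^M. p i * E (\<lambda>w. ?e w \<bullet> ((L i - A) *v v)))"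
    by (rule expect_resample[where Y="\<lambda>i w. ?e w \<bullet> ((L i - A) *v v)"]) (simp_all only: err_past[OF _ k] \<kappa>(1)[OF k])
  also have "\<dots> = (\<Sum>w\<in>Omega_K M K. weight K p w * (?e w \<bullet> (\<Sum>i=1..2^M. p i *\<^sub>R ((L i - A) *v v))))"
    unfolding expect_alt sum_distrib_left inner_sum_right by (subst sum.swap) (simp add: mult_ac)
  also have "(\<Sum>i=1..2^M. p i *\<^sub>R ((L i - A) *v v)) = 0"
    unfolding matrix_vector_mult_diff_rdistrib scaleR_diff_right sum_subtractf mean
      scaleR_sum_left[symmetric] p_sum by simp
  finally show ?thesis by simp
qed

text \<open>The derivative of the error is \<open>(L - A) xh + A err\<close>, and the force is at most \<open>|L - A| X\<close>. In the product, \<open>(L - A) xh\<close> gives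
  \<open>|L - A|\<^sup>2\<close>. The other summand must not be bounded by \<open>|A| |L - A|\<close>, which would only give the standard deviation
  instead of the variance: Young's inequality keeps \<open>|err|\<^sup>2\<close>, to be treated by Gronwall's inequality.\<close>

lemma err_increment:
  assumes w: "w \<in> Omega_K M K" and k: "k \<in> {1..K}" and s: "\<tau> (k-1) \<le> s" "s < \<tau> k"
  shows "(err w s - err w (\<tau> (k-1))) \<bullet> force w s
     \<le> (X\<^sup>2 + X * opnorm A / 2) * h * (opnorm (L (w (\<kappa> k)) - A))\<^sup>2
        + X * opnorm A / 2 * integral {0..s} (\<lambda>r. (norm (err w r))\<^sup>2)"
proof -
  let ?t = "\<tau> (k-1)" and ?l = "opnorm (L (w (\<kappa> k)) - A)" and ?a = "opnorm A"
  let ?d = "\<lambda>r. F w r *v err w r + force w r"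
  have t: "0 \<le> ?t" "\<tau> k \<le> T" "?t < \<tau> k" "\<tau> k - ?t \<le> h"
    using grid_bounds[of "k-1"] grid_bounds[of k] grid_less[OF k] grid_spacing[OF k] k by auto
  have sT: "s \<in> {0..T}" "?t \<in> {0..T}" using t s by auto
  have l0: "0 \<le> ?l" and a0: "0 \<le> ?a" by (rule opnorm_nonneg)+
  have di: "?d integrable_on {0..T}"
    by (intro set_lebesgue_integral_eq_integral(1) lin_sol_integrable F_admissible force_integrable err_cont w)
  have e2: "continuous_on {0..T} (\<lambda>r. (norm (err w r))\<^sup>2)"
    by (intro continuous_intros xh_cont x_cont w)
  have e2i: "(\<lambda>r. (norm (err w r))\<^sup>2) integrable_on {r..s}" if "0 \<le> r" for r
    by (rule integrable_continuous_real, rule continuous_on_subset[OF e2]) (use sT that in auto)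
  have eq: "err w s - err w ?t = integral {?t..s} ?d"
    using err_sol[OF w] sT integral_increment[OF di t(1) s(1)] by (simp add: lin_sol_def)
  have fb: "norm (force w s) \<le> ?l * X"
  proof -
    have "norm (force w s) \<le> ?l * norm (x s)"
      unfolding F_cell[OF k s] by (rule norm_mult_le_opnorm)
    also have "\<dots> \<le> ?l * X" by (intro mult_left_mono x_bound sT l0)
    finally show ?thesis .
  qed
  let ?c = "(X\<^sup>2 + X * ?a / 2) * ?l\<^sup>2" and ?b = "X * ?a / 2"
  have c0: "0 \<le> ?c" "0 \<le> ?b" using X_nonneg a0 by simp_all
  have "(err w s - err w ?t) \<bullet> force w s = integral {?t..s} (\<lambda>r. ?d r \<bullet> force w s)"
    unfolding eq
    using integral_linear[OF integrable_on_subinterval[OF di] bounded_linear_inner_left[of "force w s"], of ?t s] t s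
    by (simp add: o_def)
  also have "\<dots> \<le> integral {?t..s} (\<lambda>r. ?c + ?b * (norm (err w r))\<^sup>2)"
  proof (rule integral_le)
    show "(\<lambda>r. ?d r \<bullet> force w s) integrable_on {?t..s}"
      using integrable_linear[OF integrable_on_subinterval[OF di] bounded_linear_inner_left[of "force w s"], of ?t s] t s
      by (simp add: o_def)
    show "(\<lambda>r. ?c + ?b * (norm (err w r))\<^sup>2) integrable_on {?t..s}"
      by (intro integrable_add integrable_on_mult_right e2i t) auto
    fix r assume r: "r \<in> {?t..s}"
    have rT: "r \<in> {0..T}" using r t s by auto
    have Fr: "F w r = L (w (\<kappa> k))" by (rule F_cell[OF k]) (use r s in auto)
    have "?d r = (L (w (\<kappa> k)) - A) *v xh w r + A *v err w r"
      unfolding Fr by (simp add: algebra_simps)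
    also have "norm \<dots> \<le> ?l * norm (xh w r) + ?a * norm (err w r)"
      by (intro order_trans[OF norm_triangle_ineq] add_mono norm_mult_le_opnorm)
    also have "\<dots> \<le> ?l * X + ?a * norm (err w r)"
      by (intro add_right_mono mult_left_mono xh_bound w rT l0)
    finally have d: "norm (?d r) \<le> ?l * X + ?a * norm (err w r)" .
    have "?d r \<bullet> force w s \<le> norm (?d r) * norm (force w s)" by (rule norm_cauchy_schwarz)
    also have "\<dots> \<le> (?l * X + ?a * norm (err w r)) * (?l * X)"
      by (intro mult_mono d fb add_nonneg_nonneg mult_nonneg_nonneg l0 a0 X_nonneg norm_ge_zero)
    also have "\<dots> = X\<^sup>2 * ?l\<^sup>2 + ?b * (2 * ?l * norm (err w r))"
      by (simp add: power2_eq_square algebra_simps)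
    also have "\<dots> \<le> X\<^sup>2 * ?l\<^sup>2 + ?b * (?l\<^sup>2 + (norm (err w r))\<^sup>2)"
      by (intro add_left_mono mult_left_mono sum_squares_bound c0)
    finally show "?d r \<bullet> force w s \<le> ?c + ?b * (norm (err w r))\<^sup>2" by (simp add: algebra_simps)
  qed
  also have "\<dots> = ?c * (s - ?t) + ?b * integral {?t..s} (\<lambda>r. (norm (err w r))\<^sup>2)"
    using e2i[OF t(1)] s by (subst Henstock_Kurzweil_Integration.integral_add) (auto intro: integrable_on_mult_right)
  also have "\<dots> \<le> ?c * h + ?b * integral {0..s} (\<lambda>r. (norm (err w r))\<^sup>2)"
    by (intro add_mono mult_left_mono integral_subset_le e2i c0) (use s t in auto)
  finally show ?thesis by (simp add: mult_ac)
qed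

lemma expected_power:
  assumes s: "0 \<le> s" "s < T"
  shows "E (\<lambda>w. err w s \<bullet> force w s)
     \<le> (X\<^sup>2 + X * opnorm A / 2) * h * V + X * opnorm A / 2 * integral {0..s} (\<lambda>r. E (\<lambda>w. (norm (err w r))\<^sup>2))"
proof -
  obtain k where k: "k \<in> {1..K}" and ks: "\<tau> (k-1) \<le> s" "s < \<tau> k" using grid_cell[OF s] .
  let ?c = "(X\<^sup>2 + X * opnorm A / 2) * h" and ?b = "X * opnorm A / 2"
  have "E (\<lambda>w. err w s \<bullet> force w s) = E (\<lambda>w. err w (\<tau> (k-1)) \<bullet> ((L (w (\<kappa> k)) - A) *v x s)
      + (err w s - err w (\<tau> (k-1))) \<bullet> force w s)"
    by (rule expect_cong) (simp only: F_cell[OF k ks], simp add: algebra_simps)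
  also have "\<dots> = E (\<lambda>w. (err w s - err w (\<tau> (k-1))) \<bullet> force w s)"
    unfolding expect_add expect_past_force[OF k] by simp
  also have "\<dots> \<le> E (\<lambda>w. ?c * (opnorm (L (w (\<kappa> k)) - A))\<^sup>2 + ?b * integral {0..s} (\<lambda>r. (norm (err w r))\<^sup>2))"
    by (intro expect_mono err_increment k ks)
  also have "\<dots> = ?c * V + ?b * E (\<lambda>w. integral {0..s} (\<lambda>r. (norm (err w r))\<^sup>2))"
    unfolding expect_add expect_cmult expect_deviation[OF k] ..
  also have "E (\<lambda>w. integral {0..s} (\<lambda>r. (norm (err w r))\<^sup>2)) = integral {0..s} (\<lambda>r. E (\<lambda>w. (norm (err w r))\<^sup>2))"
    by (rule expect_integral[symmetric], rule integrable_continuous_real)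
      (use s in \<open>auto intro!: continuous_intros continuous_on_subset[OF xh_cont] continuous_on_subset[OF x_cont]\<close>)
  finally show ?thesis .
qed

lemma expected_error:
  assumes t: "t \<in> {0..T}"
  shows "E (\<lambda>w. (norm (err w t))\<^sup>2)
     \<le> T * (2 * X\<^sup>2 + X * opnorm A) * exp (T * X * opnorm A * T) * (h * V)"
proof -
  define psi where "psi = (\<lambda>r. E (\<lambda>w. (norm (err w r))\<^sup>2))"
  let ?c = "(X\<^sup>2 + X * opnorm A / 2) * h * V" and ?b = "X * opnorm A / 2"
  have b0: "0 \<le> ?b" using X_nonneg opnorm_nonneg[of A] by simp
  have K: "1 \<in> {1..K}" using grid_0 grid_K T_pos by (cases K) auto
  have h0: "0 \<le> h" using grid_less[OF K] grid_spacing[OF K] by simp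
  have V0: "0 \<le> V" unfolding variance[symmetric] by (intro sum_nonneg mult_nonneg_nonneg p_nonneg) auto
  have c0: "0 \<le> ?c" using X_nonneg opnorm_nonneg[of A] h0 V0 by (intro mult_nonneg_nonneg add_nonneg_nonneg) auto
  have psi0: "0 \<le> psi r" for r unfolding psi_def by (rule expect_nonneg) simp
  have cpsi: "continuous_on {0..T} psi"
    unfolding psi_def expect_alt by (intro continuous_intros xh_cont x_cont)
  have psii: "psi integrable_on {0..s}" if "s \<le> T" for s
    by (rule integrable_continuous_real, rule continuous_on_subset[OF cpsi]) (use that in auto)
  have le: "psi r \<le> 2 * T * ?c + (2 * T * ?b) * integral {0..r} psi" if r: "r \<in> {0..T}" for r
  proof -
    let ?C = "?c + ?b * integral {0..r} psi"
    let ?g = "\<lambda>s. E (\<lambda>w. err w s \<bullet> force w s)"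
    have C0: "0 \<le> ?C"
      by (intro add_nonneg_nonneg c0 mult_nonneg_nonneg b0 Henstock_Kurzweil_Integration.integral_nonneg psii psi0)
        (use r in auto)
    have ei: "(\<lambda>s. err w s \<bullet> force w s) integrable_on {0..r}" if "w \<in> Omega_K M K" for w
    proof -
      have "(\<lambda>s. force w s \<bullet> err w s) absolutely_integrable_on {0..T}"
        by (rule integrable_inner_continuous[OF force_integrable err_cont[OF that]])
      from absolutely_integrable_subinterval[OF this, of 0 r] r show ?thesis
        by (simp add: inner_commute set_lebesgue_integral_eq_integral(1))
    qed
    have "psi r \<le> E (\<lambda>w. 2 * integral {0..r} (\<lambda>s. err w s \<bullet> force w s))"
      unfolding psi_def
    proof (rule expect_mono)
      fix w assume w: "w \<in> Omega_K M K"
      show "(norm (err w r))\<^sup>2 \<le> 2 * integral {0..r} (\<lambda>s. err w s \<bullet> force w s)"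
        using energy_inequality[OF F_admissible force_integrable err_sol[OF w] F_diss[OF w] r] by simp
    qed
    also have "\<dots> = 2 * integral {0..r} ?g"
      unfolding expect_cmult by (subst expect_integral) (use ei in auto)
    \<comment> \<open>The end time belongs to no cell.\<close>
    also have "integral {0..r} ?g = integral {0..r} (\<lambda>s. if s = T then 0 else ?g s)"
      by (rule integral_spike[of "{T}"]) auto
    also have "\<dots> \<le> integral {0..r} (\<lambda>s. ?C)"
    proof (rule integral_le)
      show "(\<lambda>s. if s = T then 0 else ?g s) integrable_on {0..r}"
        by (rule integrable_spike[OF expect_integrable[OF ei], of _ "{T}"]) auto
      fix s assume s: "s \<in> {0..r}"
      show "(if s = T then 0 else ?g s) \<le> ?C"
      proof (cases "s = T")
        case False
        then have "?g s \<le> ?c + ?b * integral {0..s} psi"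
          using expected_power[of s] s r unfolding psi_def by auto
        also have "\<dots> \<le> ?C"
          by (intro add_left_mono mult_left_mono b0 integral_subset_le psii) (use s r psi0 in auto)
        finally show ?thesis using False by simp
      qed (use C0 in simp)
    qed auto
    also have "\<dots> = r * ?C" using r by simp
    also have "\<dots> \<le> T * ?C" using r C0 by (intro mult_right_mono) auto
    finally show ?thesis by (simp add: algebra_simps)
  qed
  have "psi t \<le> 2 * T * ?c * exp ((2 * T * ?b) * t)"
    by (rule gronwall_integral[OF _ cpsi _ le t]) (use T_pos b0 in auto)
  also have "\<dots> \<le> 2 * T * ?c * exp ((2 * T * ?b) * T)"
  proof -
    have "(2 * T * ?b) * t \<le> (2 * T * ?b) * T" using t T_pos b0 by (intro mult_left_mono) auto
    then show ?thesis using T_pos c0 by (intro mult_left_mono) auto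
  qed
  finally show ?thesis by (simp add: psi_def algebra_simps)
qed

end

end

section \<open>Time reversal and duality\<close>

lemma integral_reflect_interval:
  fixes a :: "real \<Rightarrow> 'a::euclidean_space"
  shows "integral {t..T} (\<lambda>s. a (T - s)) = integral {0..T - t} a"
  using Henstock_Kurzweil_Integration.integral_reflect_real[of "- t" "- T" "\<lambda>x. a (x + T)"] integral_shift_real_ivl[of 0 T "T - t" a]
  by simp

lemma integrable_reflect_interval:
  fixes a :: "real \<Rightarrow> 'a::euclidean_space"
  assumes "a integrable_on {0..T}"
  shows "(\<lambda>s. a (T - s)) integrable_on {0..T}"
proof -
  have "(\<lambda>x. a (x + T)) integrable_on {- T..0}"
    using assms integrable_on_shift_Icc_real[of a T "- T" 0] by (simp add: o_def add.commute)
  then show ?thesis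
    using Henstock_Kurzweil_Integration.integrable_reflect_real[of "\<lambda>x. a (x + T)" 0 "- T"] by simp
qed

lemma absolutely_integrable_reflect_interval:
  fixes a :: "real \<Rightarrow> 'a::euclidean_space"
  assumes "a absolutely_integrable_on {0..T}"
  shows "(\<lambda>s. a (T - s)) absolutely_integrable_on {0..T}"
  using assms integrable_reflect_interval[of a T] integrable_reflect_interval[of "\<lambda>s. norm (a s)" T]
  by (auto simp: absolutely_integrable_on_def)

text \<open>With \<open>f t = z (T - t)\<close> the derivative of \<open>y \<bullet> f\<close> is \<open>b \<bullet> f - g \<bullet> y\<close>: the coefficients cancel by
  transposition. Both end point values vanish, since \<open>y 0 = 0\<close> and \<open>f T = 0\<close>. The adjoint state is
  written in reversed time so that it is the solution of an initial value problem.\<close>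

lemma duality:
  fixes F G :: "real \<Rightarrow> real^'n^'n"
  assumes T: "0 \<le> T" and F: "admissible T F" and G: "admissible T G"
    and b: "b absolutely_integrable_on {0..T}" and g: "g absolutely_integrable_on {0..T}"
    and N: "finite N" and GF: "\<And>s. s \<in> {0..T} - N \<Longrightarrow> G s = transpose (F (T - s))"
    and y: "lin_sol T F b 0 y" and z: "lin_sol T G (\<lambda>s. g (T - s)) 0 z"
  shows "integral {0..T} (\<lambda>s. g s \<bullet> y s) = integral {0..T} (\<lambda>s. z (T - s) \<bullet> b s)"
proof -
  define k where "k = (\<lambda>s. G s *v z s + g (T - s))"
  define f where "f = (\<lambda>t. z (T - t))"
  have cy: "continuous_on {0..T} y" and cz: "continuous_on {0..T} z" using y z by (auto simp: lin_sol_def)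
  have cf: "continuous_on {0..T} f"
    unfolding f_def by (rule continuous_on_compose2[OF cz]) (auto intro!: continuous_intros)
  have k: "k absolutely_integrable_on {0..T}"
    unfolding k_def by (intro lin_sol_integrable G absolutely_integrable_reflect_interval g cz)
  have k': "(\<lambda>s. - k (T - s)) absolutely_integrable_on {0..T}"
    using absolutely_integrable_linear[OF absolutely_integrable_reflect_interval[OF k], of uminus]
    by (simp add: o_def bounded_linear_minus)
  have a: "(\<lambda>s. F s *v y s + b s) absolutely_integrable_on {0..T}"
    by (intro lin_sol_integrable F b cy)
  have z0: "z 0 = 0" using z T by (simp add: lin_sol_def)
  have f_eq: "f t = f 0 + integral {0..t} (\<lambda>s. - k (T - s))" if t: "t \<in> {0..T}" for t
  proof -
    have "f r = integral {r..T} (\<lambda>s. k (T - s))" if "r \<in> {0..T}" for r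
    proof -
      have "f r = integral {0..T - r} k" using z that by (auto simp: f_def lin_sol_def k_def)
      then show ?thesis by (simp only: integral_reflect_interval)
    qed
    moreover have "integral {0..t} (\<lambda>s. k (T - s)) + integral {t..T} (\<lambda>s. k (T - s)) = integral {0..T} (\<lambda>s. k (T - s))"
      using t by (intro Henstock_Kurzweil_Integration.integral_combine set_lebesgue_integral_eq_integral(1)
          absolutely_integrable_reflect_interval k) auto
    ultimately show ?thesis using t T by (simp add: algebra_simps)
  qed
  have y_eq: "y t = 0 + integral {0..t} (\<lambda>s. F s *v y s + b s)" if "t \<in> {0..T}" for t
    using y that by (auto simp: lin_sol_def)
  have "y T \<bullet> f T = 0 \<bullet> f 0 + integral {0..T} (\<lambda>t. (F t *v y t + b t) \<bullet> f t + y t \<bullet> - k (T - t))"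
    by (rule absolutely_continuous_product_rule[OF T a k' y_eq f_eq])
  then have "0 = integral {0..T} (\<lambda>t. (F t *v y t + b t) \<bullet> f t + y t \<bullet> - k (T - t))"
    by (simp add: f_def z0)
  also have "\<dots> = integral {0..T} (\<lambda>t. z (T - t) \<bullet> b t - g t \<bullet> y t)"
  proof (rule integral_spike[of "(\<lambda>s. T - s) ` N"])
    fix t assume t: "t \<in> {0..T} - (\<lambda>s. T - s) ` N"
    then have "T - t \<notin> N" by (metis DiffD2 diff_diff_eq2 add_diff_cancel_left' image_eqI)
    then have "G (T - t) = transpose (F t)" using t GF[of "T - t"] by simp
    then have "k (T - t) \<bullet> y t = (transpose (F t) *v f t) \<bullet> y t + g t \<bullet> y t"
      by (simp add: k_def f_def inner_add_left)
    then have "y t \<bullet> k (T - t) = (F t *v y t) \<bullet> f t + g t \<bullet> y t"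
      unfolding inner_transpose_mult by (simp add: inner_commute)
    then show "z (T - t) \<bullet> b t - g t \<bullet> y t = (F t *v y t + b t) \<bullet> f t + y t \<bullet> - k (T - t)"
      by (simp add: inner_add_left inner_add_right f_def inner_commute)
  qed (use N in auto)
  also have "\<dots> = integral {0..T} (\<lambda>t. z (T - t) \<bullet> b t) - integral {0..T} (\<lambda>t. g t \<bullet> y t)"
    using set_lebesgue_integral_eq_integral(1)[OF integrable_inner_continuous[OF b cf]]
      set_lebesgue_integral_eq_integral(1)[OF integrable_inner_continuous[OF g cy]]
    by (intro Henstock_Kurzweil_Integration.integral_diff) (simp_all add: f_def inner_commute)
  finally show ?thesis by simp
qed

section \<open>Square integrable functions\<close>

lemma L2_integrable_square: "u \<in> L2 T \<Longrightarrow> (\<lambda>t. (norm (u t))\<^sup>2) integrable_on {0..T}"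
  unfolding L2_def by (auto intro: integrable_on_lebesgue_on)

lemma absolutely_integrable_dominated:
  fixes w :: "real \<Rightarrow> 'a::euclidean_space"
  assumes w: "w \<in> borel_measurable (lebesgue_on {0..T})" and G: "integrable (lebesgue_on {0..T}) G"
    and le: "\<And>t. norm (w t) \<le> G t"
  shows "w absolutely_integrable_on {0..T}"
proof -
  have "integrable (lebesgue_on {0..T}) (norm \<circ> w)"
    by (rule Bochner_Integration.integrable_bound[OF G])
      (use w le in \<open>auto simp: o_def intro: order_trans[OF le abs_ge_self]\<close>)
  then show ?thesis using w by (simp add: absolutely_integrable_measurable)
qed

lemma L2_absolutely_integrable:
  fixes u :: "real \<Rightarrow> 'a::euclidean_space"
  assumes "u \<in> L2 T"
  shows "u absolutely_integrable_on {0..T}"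
proof (rule absolutely_integrable_dominated)
  show "integrable (lebesgue_on {0..T}) (\<lambda>t. 1 + (norm (u t))\<^sup>2)"
    using assms by (auto simp: L2_def intro!: Bochner_Integration.integrable_add)
  show "norm (u t) \<le> 1 + (norm (u t))\<^sup>2" for t
    using sum_squares_bound[of 1 "norm (u t)"] norm_ge_zero[of "u t"]
    unfolding power_one mult_1_right by linarith
qed (use assms in \<open>simp add: L2_def\<close>)

lemma L2_inner_integrable:
  fixes u v :: "real \<Rightarrow> 'a::euclidean_space"
  assumes "u \<in> L2 T" "v \<in> L2 T"
  shows "(\<lambda>t. u t \<bullet> v t) absolutely_integrable_on {0..T}"
proof (rule absolutely_integrable_dominated)
  show "integrable (lebesgue_on {0..T}) (\<lambda>t. (norm (u t))\<^sup>2 + (norm (v t))\<^sup>2)"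
    using assms by (auto simp: L2_def)
  show "norm (u t \<bullet> v t) \<le> (norm (u t))\<^sup>2 + (norm (v t))\<^sup>2" for t
  proof -
    have "0 \<le> norm (u t) * norm (v t)" by simp
    then show ?thesis
      using Cauchy_Schwarz_ineq2[of "u t" "v t"] sum_squares_bound[of "norm (u t)" "norm (v t)"]
      unfolding real_norm_def mult.assoc by linarith
  qed
qed (use assms in \<open>auto simp: L2_def\<close>)

lemma L2_I:
  fixes u :: "real \<Rightarrow> 'a::euclidean_space"
  assumes "u \<in> borel_measurable (lebesgue_on {0..T})" "G absolutely_integrable_on {0..T}"
    "\<And>t. (norm (u t))\<^sup>2 \<le> (G t :: real)"
  shows "u \<in> L2 T"
proof -
  have "integrable (lebesgue_on {0..T}) (\<lambda>t. (norm (u t))\<^sup>2)"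
    by (rule Bochner_Integration.integrable_bound[OF absolutely_integrable_imp_integrable[OF assms(2)]])
      (use assms(1,3) in \<open>auto intro: order_trans[OF assms(3) abs_ge_self]\<close>)
  then show ?thesis using assms(1) by (simp add: L2_def)
qed

lemma L2_square: "u \<in> L2 T \<Longrightarrow> (\<lambda>t. (norm (u t))\<^sup>2) absolutely_integrable_on {0..T}"
  using L2_inner_integrable[of u T u] by (simp add: power2_norm_eq_inner)

lemma L2_add_scaleR:
  fixes u v :: "real \<Rightarrow> 'a::euclidean_space"
  assumes u: "u \<in> L2 T" and v: "v \<in> L2 T"
  shows "(\<lambda>t. u t + c *\<^sub>R v t) \<in> L2 T"
proof (rule L2_I)
  show "(\<lambda>t. u t + c *\<^sub>R v t) \<in> borel_measurable (lebesgue_on {0..T})" using u v by (auto simp: L2_def)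
  show "(\<lambda>t. 2 * (norm (u t))\<^sup>2 + 2 * c\<^sup>2 * (norm (v t))\<^sup>2) absolutely_integrable_on {0..T}"
    by (intro set_integral_add set_integrable_mult_right L2_square u v)
  show "(norm (u t + c *\<^sub>R v t))\<^sup>2 \<le> 2 * (norm (u t))\<^sup>2 + 2 * c\<^sup>2 * (norm (v t))\<^sup>2" for t
  proof -
    have "(norm (u t + c *\<^sub>R v t))\<^sup>2 \<le> (norm (u t) + \<bar>c\<bar> * norm (v t))\<^sup>2"
      by (intro power_mono) (use norm_triangle_ineq[of "u t" "c *\<^sub>R v t"] in auto)
    also have "\<dots> \<le> 2 * (norm (u t))\<^sup>2 + 2 * (\<bar>c\<bar> * norm (v t))\<^sup>2"
      using sum_squares_bound[of "norm (u t)" "\<bar>c\<bar> * norm (v t)"] by (simp add: power2_sum)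
    finally show ?thesis by (simp add: power_mult_distrib)
  qed
qed

lemma L2_matrix:
  fixes X :: "real^'n^'m"
  assumes u: "u \<in> L2 T"
  shows "(\<lambda>t. X *v u t) \<in> L2 T"
proof (rule L2_I)
  show "(\<lambda>t. X *v u t) \<in> borel_measurable (lebesgue_on {0..T})"
    by (intro absolutely_integrable_imp_borel_measurable matrix_mult_integrable L2_absolutely_integrable u) auto
  show "(\<lambda>t. (opnorm X)\<^sup>2 * (norm (u t))\<^sup>2) absolutely_integrable_on {0..T}"
    by (intro set_integrable_mult_right L2_square u)
  show "(norm (X *v u t))\<^sup>2 \<le> (opnorm X)\<^sup>2 * (norm (u t))\<^sup>2" for t
    unfolding power_mult_distrib[symmetric] by (intro power_mono norm_mult_le_opnorm) auto
qed

lemma L2_continuous: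
  fixes x :: "real \<Rightarrow> 'a::euclidean_space"
  assumes x: "continuous_on {0..T} x"
  shows "x \<in> L2 T"
proof -
  have "(\<lambda>t. (norm (x t))\<^sup>2) absolutely_integrable_on {0..T}"
    by (intro absolutely_integrable_continuous_real continuous_intros x)
  then show ?thesis
    using x by (simp add: L2_def continuous_imp_measurable_on_sets_lebesgue absolutely_integrable_imp_integrable)
qed

section \<open>The linear-quadratic problem\<close>

lemma symmetric_inner: "symmetric_matrix X \<Longrightarrow> (X *v a) \<bullet> b = a \<bullet> (X *v b)"
  using inner_transpose_mult[of X a b] by (simp add: symmetric_matrix_def)

lemma solves_ivp_iff:
  assumes F: "admissible T F" and u: "u \<in> L2 T"
  shows "solves_ivp T F B x0 u x \<longleftrightarrow> lin_sol T F (\<lambda>s. B *v u s) x0 x"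
proof -
  have "(LINT s|lebesgue_on {0..t}. F s *v x s + B *v u s) = integral {0..t} (\<lambda>s. F s *v x s + B *v u s)"
    if x: "continuous_on {0..T} x" and t: "t \<in> {0..T}" for t
  proof -
    have "(\<lambda>s. F s *v x s + B *v u s) absolutely_integrable_on {0..T}"
      by (intro lin_sol_integrable F x matrix_mult_integrable L2_absolutely_integrable u)
    then have "(\<lambda>s. F s *v x s + B *v u s) absolutely_integrable_on {0..t}"
      by (rule absolutely_integrable_subinterval) (use t in auto)
    then show ?thesis
      by (intro lebesgue_integral_eq_integral absolutely_integrable_imp_integrable) auto
  qed
  then show ?thesis by (auto simp: solves_ivp_def lin_sol_def)
qed

lemma state_sol:
  assumes "0 \<le> T" "admissible T F" "u \<in> L2 T"
  shows "lin_sol T F (\<lambda>s. B *v u s) x0 (state T F B x0 u)"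
proof -
  obtain x where "lin_sol T F (\<lambda>s. B *v u s) x0 x"
    using lin_sol_exists[OF assms(1,2) matrix_mult_integrable[OF L2_absolutely_integrable[OF assms(3)]]]
    by blast
  then have "solves_ivp T F B x0 u x" unfolding solves_ivp_iff[OF assms(2,3)] .
  then have "solves_ivp T F B x0 u (state T F B x0 u)" unfolding state_def by (rule someI[of "solves_ivp T F B x0 u"])
  then show ?thesis unfolding solves_ivp_iff[OF assms(2,3)] .
qed

lemma quadratic_expansion:
  fixes Q :: "real^'n^'n"
  assumes Q: "symmetric_matrix Q" and a: "a \<in> L2 T" and b: "b \<in> L2 T"
  shows "integral {0..T} (\<lambda>t. (a t + c *\<^sub>R b t) \<bullet> (Q *v (a t + c *\<^sub>R b t)))
    = integral {0..T} (\<lambda>t. a t \<bullet> (Q *v a t)) + 2 * c * integral {0..T} (\<lambda>t. (Q *v a t) \<bullet> b t)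
      + c\<^sup>2 * integral {0..T} (\<lambda>t. b t \<bullet> (Q *v b t))"
proof -
  have i: "(\<lambda>t. a t \<bullet> (Q *v a t)) integrable_on {0..T}" "(\<lambda>t. (Q *v a t) \<bullet> b t) integrable_on {0..T}"
    "(\<lambda>t. b t \<bullet> (Q *v b t)) integrable_on {0..T}"
    by (intro set_lebesgue_integral_eq_integral(1) L2_inner_integrable L2_matrix a b)+
  have "(a t + c *\<^sub>R b t) \<bullet> (Q *v (a t + c *\<^sub>R b t))
      = a t \<bullet> (Q *v a t) + 2 * c * ((Q *v a t) \<bullet> b t) + c\<^sup>2 * (b t \<bullet> (Q *v b t))" for t
    using symmetric_inner[OF Q, of "a t" "b t"]
    by (simp add: matrix_vector_right_distrib matrix_vector_mult_scaleR inner_add_left inner_add_right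
        power2_eq_square algebra_simps) (simp add: inner_commute)
  then have "integral {0..T} (\<lambda>t. (a t + c *\<^sub>R b t) \<bullet> (Q *v (a t + c *\<^sub>R b t)))
    = integral {0..T} (\<lambda>t. a t \<bullet> (Q *v a t) + 2 * c * ((Q *v a t) \<bullet> b t) + c\<^sup>2 * (b t \<bullet> (Q *v b t)))"
    by simp
  also have "\<dots> = integral {0..T} (\<lambda>t. a t \<bullet> (Q *v a t) + 2 * c * ((Q *v a t) \<bullet> b t))
      + integral {0..T} (\<lambda>t. c\<^sup>2 * (b t \<bullet> (Q *v b t)))"
    by (intro Henstock_Kurzweil_Integration.integral_add integrable_add integrable_on_mult_right i)
  also have "integral {0..T} (\<lambda>t. a t \<bullet> (Q *v a t) + 2 * c * ((Q *v a t) \<bullet> b t))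
      = integral {0..T} (\<lambda>t. a t \<bullet> (Q *v a t)) + integral {0..T} (\<lambda>t. 2 * c * ((Q *v a t) \<bullet> b t))"
    by (intro Henstock_Kurzweil_Integration.integral_add integrable_add integrable_on_mult_right i)
  finally show ?thesis by simp
qed

lemma cost_split:
  assumes d: "(\<lambda>t. x t - xd t) \<in> L2 T" and u: "u \<in> L2 T"
  shows "cost T Q R xd x u = 1/2 * (integral {0..T} (\<lambda>t. (x t - xd t) \<bullet> (Q *v (x t - xd t)))
    + integral {0..T} (\<lambda>t. u t \<bullet> (R *v u t)))"
proof -
  have 1: "(\<lambda>t. (x t - xd t) \<bullet> (Q *v (x t - xd t))) absolutely_integrable_on {0..T}"
    by (intro L2_inner_integrable L2_matrix d)
  have 2: "(\<lambda>t. u t \<bullet> (R *v u t)) absolutely_integrable_on {0..T}"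
    by (intro L2_inner_integrable L2_matrix u)
  have "(LINT t|lebesgue_on {0..T}. (x t - xd t) \<bullet> (Q *v (x t - xd t)) + u t \<bullet> (R *v u t))
      = integral {0..T} (\<lambda>t. (x t - xd t) \<bullet> (Q *v (x t - xd t)) + u t \<bullet> (R *v u t))"
    by (intro lebesgue_integral_eq_integral absolutely_integrable_imp_integrable set_integral_add(1) 1 2) auto
  also have "\<dots> = integral {0..T} (\<lambda>t. (x t - xd t) \<bullet> (Q *v (x t - xd t)))
    + integral {0..T} (\<lambda>t. u t \<bullet> (R *v u t))"
    by (intro Henstock_Kurzweil_Integration.integral_add set_lebesgue_integral_eq_integral(1) 1 2)
  finally show ?thesis unfolding cost_def by simp
qed

lemma cost_cong: "(\<And>t. t \<in> {0..T} \<Longrightarrow> x t = y t) \<Longrightarrow> cost T Q R xd x u = cost T Q R xd y u"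
  unfolding cost_def by (intro arg_cong[where f="\<lambda>r. 1/2 * r"] Bochner_Integration.integral_cong) auto

text \<open>The minimum of the quadratic form over the compact unit sphere is positive.\<close>

lemma pos_def_coercive:
  fixes R :: "real^'q^'q"
  assumes "pos_def R"
  shows "\<exists>\<alpha>>0. \<forall>v. \<alpha> * (norm v)\<^sup>2 \<le> v \<bullet> (R *v v)"
proof -
  have "continuous_on (sphere 0 1) (\<lambda>v::real^'q. v \<bullet> (R *v v))"
    by (intro continuous_intros linear_continuous_on) simp
  moreover have "sphere 0 1 \<noteq> ({} :: (real^'q) set)" by simp
  ultimately obtain w where "w \<in> sphere 0 1" and "\<forall>v\<in>sphere 0 1. w \<bullet> (R *v w) \<le> v \<bullet> (R *v v)"
    using continuous_attains_inf[OF compact_sphere] by blast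
  then have w: "norm w = 1" and min: "\<And>v. norm v = 1 \<Longrightarrow> w \<bullet> (R *v w) \<le> v \<bullet> (R *v v)"
    by auto
  have "w \<noteq> 0" using w by auto
  then have "0 < w \<bullet> (R *v w)" using assms by (simp add: pos_def_def)
  moreover have "(w \<bullet> (R *v w)) * (norm v)\<^sup>2 \<le> v \<bullet> (R *v v)" for v
  proof (cases "v = 0")
    case False
    then have "w \<bullet> (R *v w) \<le> (v /\<^sub>R norm v) \<bullet> (R *v (v /\<^sub>R norm v))" by (intro min) simp
    also have "\<dots> = (v \<bullet> (R *v v)) / (norm v)\<^sup>2"
      by (simp add: matrix_vector_mult_scaleR power2_eq_square divide_inverse)
    finally show ?thesis using False by (simp add: field_simps)
  qed simp
  ultimately show ?thesis by blast
qed

lemma quadratic_nonneg_imp_linear_zero: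
  fixes D S :: real
  assumes "\<And>c. 0 \<le> c * D + c\<^sup>2 * S"
  shows "D = 0"
proof (rule ccontr)
  assume D: "D \<noteq> 0"
  define m where "m = \<bar>S\<bar> + 1"
  have m: "m > 0" "S < m" by (auto simp: m_def)
  have "(- D / m) * D + (- D / m)\<^sup>2 * S = D\<^sup>2 / m\<^sup>2 * (S - m)"
    using m by (simp add: field_simps power2_eq_square)
  also have "\<dots> < 0" using D m by (intro mult_pos_neg) auto
  finally show False using assms[of "- D / m"] by simp
qed

lemma integral_norm_square_le:
  fixes v :: "real \<Rightarrow> 'a::euclidean_space"
  assumes T: "0 < T" and v: "v \<in> L2 T"
  shows "(integral {0..T} (\<lambda>t. norm (v t)))\<^sup>2 \<le> T * integral {0..T} (\<lambda>t. (norm (v t))\<^sup>2)"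
proof -
  define I where "I = integral {0..T} (\<lambda>t. norm (v t))"
  define m where "m = I / T"
  have i1: "(\<lambda>t. norm (v t)) integrable_on {0..T}"
    using absolutely_integrable_norm[OF L2_absolutely_integrable[OF v]]
    by (simp add: o_def set_lebesgue_integral_eq_integral(1))
  have i2: "(\<lambda>t. (norm (v t))\<^sup>2) integrable_on {0..T}" by (rule L2_integrable_square[OF v])
  have "integral {0..T} (\<lambda>t. 2 * m * norm (v t)) \<le> integral {0..T} (\<lambda>t. m\<^sup>2 + (norm (v t))\<^sup>2)"
    by (intro integral_le integrable_on_mult_right integrable_add i1 i2) (auto simp: sum_squares_bound)
  also have "\<dots> = integral {0..T} (\<lambda>t. m\<^sup>2) + integral {0..T} (\<lambda>t. (norm (v t))\<^sup>2)"
    by (intro Henstock_Kurzweil_Integration.integral_add i2) auto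
  finally have "2 * m * I \<le> T * m\<^sup>2 + integral {0..T} (\<lambda>t. (norm (v t))\<^sup>2)"
    using T by (simp add: I_def)
  moreover have "m * T = I" using T by (simp add: m_def)
  then have "2 * m * I = 2 * (m\<^sup>2 * T)" by (simp add: power2_eq_square mult.assoc) 
  ultimately have "m\<^sup>2 * T \<le> integral {0..T} (\<lambda>t. (norm (v t))\<^sup>2)" by (simp add: mult_ac)
  then have "T * (m\<^sup>2 * T) \<le> T * integral {0..T} (\<lambda>t. (norm (v t))\<^sup>2)" using T by simp
  moreover have "T * (m\<^sup>2 * T) = I\<^sup>2" unfolding \<open>m * T = I\<close>[symmetric] by (simp add: power2_eq_square)
  ultimately show ?thesis by (simp add: I_def)
qed

locale lq_problem =
  fixes T :: real and B :: "real^'q^'n" and x0 :: "real^'n" and xd :: "real \<Rightarrow> real^'n"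
    and Q :: "real^'n^'n" and R :: "real^'q^'q" and \<alpha> :: real
  assumes T: "0 < T" and xd: "xd \<in> L2 T"
    and Q_sym: "symmetric_matrix Q" and Q_psd: "pos_semidef Q" and R_sym: "symmetric_matrix R"
    and \<alpha>: "0 < \<alpha>" and R_coercive: "\<And>v. \<alpha> * (norm v)\<^sup>2 \<le> v \<bullet> (R *v v)"
begin

abbreviation state_of where "state_of F u \<equiv> state T F B x0 u"
abbreviation cost_of where "cost_of F u \<equiv> cost T Q R xd (state_of F u) u"

lemma forcing: "u \<in> L2 T \<Longrightarrow> (\<lambda>s. B *v u s) absolutely_integrable_on {0..T}"
  by (intro matrix_mult_integrable L2_absolutely_integrable)

lemma state_cont: "admissible T F \<Longrightarrow> u \<in> L2 T \<Longrightarrow> continuous_on {0..T} (state_of F u)"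
  using state_sol[of T F u B x0] T by (auto simp: lin_sol_def)

lemma L2_diff: "u \<in> L2 T \<Longrightarrow> v \<in> L2 T \<Longrightarrow> (\<lambda>t. u t - v t) \<in> L2 T"
  for u v :: "real \<Rightarrow> 'a::euclidean_space"
  using L2_add_scaleR[of u T v "-1"] by simp

lemma misfit_L2: "admissible T F \<Longrightarrow> u \<in> L2 T \<Longrightarrow> (\<lambda>t. state_of F u t - xd t) \<in> L2 T"
  by (rule L2_diff[OF L2_continuous[OF state_cont] xd])

text \<open>The state is affine in the control, so the cost is exactly quadratic along lines.\<close>

lemma cost_expansion:
  assumes F: "admissible T F" and diss: "\<And>t. t \<in> {0..T} \<Longrightarrow> dissipative (F t)"
    and u: "u \<in> L2 T" and v: "v \<in> L2 T" and y: "lin_sol T F (\<lambda>s. B *v v s) 0 y"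
  shows "cost_of F (\<lambda>t. u t + c *\<^sub>R v t) = cost_of F u
    + c * (integral {0..T} (\<lambda>t. (Q *v (state_of F u t - xd t)) \<bullet> y t) + integral {0..T} (\<lambda>t. (R *v u t) \<bullet> v t))
    + c\<^sup>2 * ((integral {0..T} (\<lambda>t. y t \<bullet> (Q *v y t)) + integral {0..T} (\<lambda>t. v t \<bullet> (R *v v t))) / 2)"
proof -
  let ?x = "state_of F u" and ?uv = "\<lambda>t. u t + c *\<^sub>R v t"
  have uv: "?uv \<in> L2 T" by (rule L2_add_scaleR[OF u v])
  have yL: "y \<in> L2 T" using y by (intro L2_continuous) (simp add: lin_sol_def)
  have "lin_sol T F (\<lambda>s. B *v u s + c *\<^sub>R (B *v v s + (F s - F s) *v y s)) (x0 + c *\<^sub>R 0) (\<lambda>t. ?x t + c *\<^sub>R y t)"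
    by (rule lin_sol_combine[OF F F forcing[OF u] forcing[OF v] state_sol y]) (use T F u in auto)
  then have sol: "lin_sol T F (\<lambda>s. B *v ?uv s) x0 (\<lambda>t. ?x t + c *\<^sub>R y t)"
    by (simp add: matrix_vector_right_distrib matrix_vector_mult_scaleR)
  have "state_of F ?uv t = ?x t + c *\<^sub>R y t" if "t \<in> {0..T}" for t
    by (rule lin_sol_unique[OF F forcing[OF uv] state_sol sol diss that]) (use T F uv in auto)
  then have "cost_of F ?uv = cost T Q R xd (\<lambda>t. ?x t + c *\<^sub>R y t) ?uv" by (rule cost_cong)
  also have "\<dots> = 1/2 * (integral {0..T} (\<lambda>t. ((?x t - xd t) + c *\<^sub>R y t) \<bullet> (Q *v ((?x t - xd t) + c *\<^sub>R y t)))
    + integral {0..T} (\<lambda>t. ?uv t \<bullet> (R *v ?uv t)))"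
    using cost_split[OF _ uv, of "\<lambda>t. ?x t + c *\<^sub>R y t" xd Q R] L2_add_scaleR[OF misfit_L2[OF F u] yL, of c]
    by (simp add: algebra_simps)
  also have "\<dots> = cost_of F u
    + c * (integral {0..T} (\<lambda>t. (Q *v (?x t - xd t)) \<bullet> y t) + integral {0..T} (\<lambda>t. (R *v u t) \<bullet> v t))
    + c\<^sup>2 * ((integral {0..T} (\<lambda>t. y t \<bullet> (Q *v y t)) + integral {0..T} (\<lambda>t. v t \<bullet> (R *v v t))) / 2)"
    unfolding quadratic_expansion[OF Q_sym misfit_L2[OF F u] yL] quadratic_expansion[OF R_sym u v]
      cost_split[OF misfit_L2[OF F u] u]
    by (simp add: field_simps)
  finally show ?thesis .
qed

lemma stationarity:
  assumes F: "admissible T F" and diss: "\<And>t. t \<in> {0..T} \<Longrightarrow> dissipative (F t)"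
    and u: "u \<in> L2 T" and min: "\<And>w. w \<in> L2 T \<Longrightarrow> cost_of F u \<le> cost_of F w"
    and v: "v \<in> L2 T" and y: "lin_sol T F (\<lambda>s. B *v v s) 0 y"
  shows "integral {0..T} (\<lambda>t. (Q *v (state_of F u t - xd t)) \<bullet> y t) + integral {0..T} (\<lambda>t. (R *v u t) \<bullet> v t) = 0"
proof (rule quadratic_nonneg_imp_linear_zero)
  fix c
  show "0 \<le> c * (integral {0..T} (\<lambda>t. (Q *v (state_of F u t - xd t)) \<bullet> y t) + integral {0..T} (\<lambda>t. (R *v u t) \<bullet> v t))
    + c\<^sup>2 * ((integral {0..T} (\<lambda>t. y t \<bullet> (Q *v y t)) + integral {0..T} (\<lambda>t. v t \<bullet> (R *v v t))) / 2)"
    using cost_expansion[OF F diss u v y, of c] min[OF L2_add_scaleR[OF u v, of c]] by linarith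
qed

lemma cost_ge:
  assumes F: "admissible T F" and u: "u \<in> L2 T"
  shows "\<alpha> / 2 * integral {0..T} (\<lambda>t. (norm (u t))\<^sup>2) \<le> cost_of F u"
proof -
  have "0 \<le> integral {0..T} (\<lambda>t. (state_of F u t - xd t) \<bullet> (Q *v (state_of F u t - xd t)))"
    using Q_psd by (intro Henstock_Kurzweil_Integration.integral_nonneg set_lebesgue_integral_eq_integral(1)
        L2_inner_integrable L2_matrix misfit_L2 F u) (simp add: pos_semidef_def)
  moreover have "integral {0..T} (\<lambda>t. \<alpha> * (norm (u t))\<^sup>2) \<le> integral {0..T} (\<lambda>t. u t \<bullet> (R *v u t))"
    by (intro integral_le integrable_on_mult_right L2_integrable_square set_lebesgue_integral_eq_integral(1)
        L2_inner_integrable L2_matrix u R_coercive)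
  ultimately show ?thesis unfolding cost_split[OF misfit_L2[OF F u] u] by simp
qed

end

section \<open>Stability of the optimal value\<close>

lemma young_inequality: "0 < d \<Longrightarrow> k * x * y \<le> k\<^sup>2 / (4 * d) * x\<^sup>2 + d * y\<^sup>2" for d k x y :: real
proof -
  assume d: "0 < d"
  have "0 \<le> d * (y - k * x / (2 * d))\<^sup>2" using d by simp
  also have "\<dots> = k\<^sup>2 / (4 * d) * x\<^sup>2 + d * y\<^sup>2 - k * x * y"
    using d by (simp add: field_simps power2_eq_square)
  finally show ?thesis by simp
qed

context lq_problem
begin

text \<open>These constants come from the two applications of Young's inequality in \<open>suboptimality\<close>, each of which may
  consume \<open>\<alpha>/4\<close> of the coercivity constant.\<close>

definition c_state where "c_state = (opnorm Q)\<^sup>2 * (4 * T\<^sup>2 * ((opnorm B)\<^sup>2 + 1)) / \<alpha>"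
definition c_adjoint where "c_adjoint = (opnorm B)\<^sup>2 / \<alpha>"

text \<open>A minimizer \<open>u\<close> for the constant coefficient \<open>A\<close> is almost optimal for \<open>F\<close>, with a loss
  quadratic in the errors. The competitor \<open>uh\<close> enters only through \<open>v = uh - u\<close>, which
  coercivity removes; hence the right-hand side does not depend on \<open>uh\<close>.\<close>

lemma suboptimality:
  fixes A :: "real^'n^'n" and F G :: "real \<Rightarrow> real^'n^'n"
  defines "x \<equiv> state_of (\<lambda>t. A)"
  defines "g \<equiv> \<lambda>u t. Q *v (x u t - xd t)"
  assumes A: "dissipative A"
    and F: "admissible T F" and diss: "\<And>t. t \<in> {0..T} \<Longrightarrow> dissipative (F t)"
    and G: "admissible T G" and N: "finite N" and GF: "\<And>s. s \<in> {0..T} - N \<Longrightarrow> G s = transpose (F (T - s))"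
    and u: "u \<in> L2 T" and min: "\<And>w. w \<in> L2 T \<Longrightarrow> cost_of (\<lambda>t. A) u \<le> cost_of (\<lambda>t. A) w"
    and uh: "uh \<in> L2 T"
    and z: "lin_sol T (\<lambda>t. transpose A) (\<lambda>s. g u (T - s)) 0 z"
    and zh: "lin_sol T G (\<lambda>s. g u (T - s)) 0 zh"
  shows "cost_of F u - cost_of F uh
    \<le> c_state * integral {0..T} (\<lambda>t. (norm (state_of F u t - x u t))\<^sup>2)
      + c_adjoint * integral {0..T} (\<lambda>t. (norm (zh (T - t) - z (T - t)))\<^sup>2)"
proof -
  let ?v = "\<lambda>t. uh t - u t" and ?b = "opnorm B" and ?q = "opnorm Q"
  let ?e = "\<lambda>t. state_of F u t - x u t" and ?r = "\<lambda>t. zh (T - t) - z (T - t)"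
  have T0: "0 \<le> T" using T by simp
  have v: "?v \<in> L2 T" by (rule L2_diff[OF uh u])
  have Ac: "admissible T (\<lambda>t. A)" by (rule admissible_const)
  obtain y where y: "lin_sol T (\<lambda>t. A) (\<lambda>s. B *v ?v s) 0 y"
    using lin_sol_exists[OF T0 Ac forcing[OF v]] by blast
  obtain yh where yh: "lin_sol T F (\<lambda>s. B *v ?v s) 0 yh"
    using lin_sol_exists[OF T0 F forcing[OF v]] by blast
  have yhc: "continuous_on {0..T} yh" using yh by (simp add: lin_sol_def)
  have ec: "continuous_on {0..T} ?e"
    unfolding x_def by (intro continuous_intros state_cont F Ac u)
  have rc: "continuous_on {0..T} ?r"
  proof -
    have "continuous_on {0..T} (\<lambda>t. zh t - z t)"
      using z zh by (intro continuous_intros) (auto simp: lin_sol_def)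
    then show ?thesis
      by (rule continuous_on_compose2[where f="\<lambda>t. T - t"]) (auto intro!: continuous_intros)
  qed
  have gL: "g u \<in> L2 T" unfolding g_def x_def by (intro L2_matrix misfit_L2 Ac u)
  have gi: "g u absolutely_integrable_on {0..T}" by (rule L2_absolutely_integrable[OF gL])
  note int = set_lebesgue_integral_eq_integral(1)[OF L2_inner_integrable]
  note yhL = L2_continuous[OF yhc] and eL = L2_continuous[OF ec] and rL = L2_continuous[OF rc]
  have BvL: "(\<lambda>t. B *v ?v t) \<in> L2 T" by (rule L2_matrix[OF v])
  define n where "n = integral {0..T} (\<lambda>t. (norm (?v t))\<^sup>2)"
  have n0: "0 \<le> n" unfolding n_def by (rule Henstock_Kurzweil_Integration.integral_nonneg[OF L2_integrable_square[OF v]]) simp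
  have stat: "integral {0..T} (\<lambda>t. g u t \<bullet> y t) + integral {0..T} (\<lambda>t. (R *v u t) \<bullet> ?v t) = 0"
    unfolding g_def x_def by (rule stationarity[OF Ac A u min v y])
  have dual: "integral {0..T} (\<lambda>t. g u t \<bullet> yh t) = integral {0..T} (\<lambda>s. zh (T - s) \<bullet> (B *v ?v s))"
    by (rule duality[OF T0 F G forcing[OF v] gi N GF yh zh])
  have dual0: "integral {0..T} (\<lambda>t. g u t \<bullet> y t) = integral {0..T} (\<lambda>s. z (T - s) \<bullet> (B *v ?v s))"
    by (rule duality[OF T0 Ac admissible_const forcing[OF v] gi _ _ y z, of "{}"]) auto
  have adj: "integral {0..T} (\<lambda>t. g u t \<bullet> yh t) - integral {0..T} (\<lambda>t. g u t \<bullet> y t)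
      = integral {0..T} (\<lambda>s. ?r s \<bullet> (B *v ?v s))"
  proof -
    have "continuous_on {0..T} (\<lambda>t. zh (T - t))" "continuous_on {0..T} (\<lambda>t. z (T - t))"
      using z zh by (auto simp: lin_sol_def intro!: continuous_on_compose2[where f="\<lambda>t. T - t"] continuous_intros)
    then show ?thesis unfolding dual dual0 inner_diff_left
      by (intro Henstock_Kurzweil_Integration.integral_diff[symmetric] int L2_continuous BvL)
  qed
  have split: "integral {0..T} (\<lambda>t. (Q *v (state_of F u t - xd t)) \<bullet> yh t)
      = integral {0..T} (\<lambda>t. (Q *v ?e t) \<bullet> yh t) + integral {0..T} (\<lambda>t. g u t \<bullet> yh t)"
  proof -
    have "(Q *v (state_of F u t - xd t)) \<bullet> yh t = (Q *v ?e t) \<bullet> yh t + g u t \<bullet> yh t" for t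
      by (simp add: g_def algebra_simps)
    then show ?thesis
      using Henstock_Kurzweil_Integration.integral_add[OF int[OF L2_matrix[OF eL] yhL] int[OF gL yhL]] by simp
  qed
  have psd: "0 \<le> integral {0..T} (\<lambda>t. yh t \<bullet> (Q *v yh t))"
    using Q_psd by (intro Henstock_Kurzweil_Integration.integral_nonneg int L2_matrix yhL) (simp add: pos_semidef_def)
  have coer: "\<alpha> * n \<le> integral {0..T} (\<lambda>t. ?v t \<bullet> (R *v ?v t))"
  proof -
    have "integral {0..T} (\<lambda>t. \<alpha> * (norm (?v t))\<^sup>2) \<le> integral {0..T} (\<lambda>t. ?v t \<bullet> (R *v ?v t))"
      by (intro integral_le integrable_on_mult_right L2_integrable_square int L2_matrix v R_coercive)
    then show ?thesis by (simp add: n_def)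
  qed
  have exp: "cost_of F uh = cost_of F u
    + (integral {0..T} (\<lambda>t. (Q *v (state_of F u t - xd t)) \<bullet> yh t) + integral {0..T} (\<lambda>t. (R *v u t) \<bullet> ?v t))
    + (integral {0..T} (\<lambda>t. yh t \<bullet> (Q *v yh t)) + integral {0..T} (\<lambda>t. ?v t \<bullet> (R *v ?v t))) / 2"
    using cost_expansion[OF F diss u v yh, of 1] by simp
  \<comment> \<open>The weight \<open>d\<close> is chosen such that \<open>T d Y\<^sup>2 \<le> \<alpha>/4 n\<close>, where \<open>Y\<close> bounds \<open>yh\<close>
    and \<open>Y\<^sup>2\<close> is at most \<open>4 T (opnorm B)\<^sup>2 n\<close>. The summand 1 covers \<open>B = 0\<close>.\<close>
  define d where "d = \<alpha> / (16 * T\<^sup>2 * (?b\<^sup>2 + 1))"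
  have b1: "?b\<^sup>2 + 1 > 0" by (rule add_nonneg_pos) auto
  have d0: "d > 0" unfolding d_def using \<alpha> T b1 by simp
  have cd: "?q\<^sup>2 / (4 * d) = c_state" unfolding c_state_def d_def using \<alpha> T b1 by (simp add: field_simps)
  define Y where "Y = 2 * integral {0..T} (\<lambda>s. norm (B *v ?v s))"
  have yhY: "norm (yh t) \<le> Y" if "t \<in> {0..T}" for t
    using dissipative_bound[OF F forcing[OF v] yh diss that] by (simp add: Y_def)
  have "Y\<^sup>2 \<le> 4 * (T * integral {0..T} (\<lambda>t. (norm (B *v ?v t))\<^sup>2))"
    using integral_norm_square_le[OF T BvL] by (simp add: Y_def power_mult_distrib)
  also have "integral {0..T} (\<lambda>t. (norm (B *v ?v t))\<^sup>2) \<le> integral {0..T} (\<lambda>t. ?b\<^sup>2 * (norm (?v t))\<^sup>2)"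
    by (intro integral_le integrable_on_mult_right L2_integrable_square v BvL, unfold power_mult_distrib[symmetric])
      (intro power_mono norm_mult_le_opnorm norm_ge_zero)
  finally have Y2: "Y\<^sup>2 \<le> 4 * (T * (?b\<^sup>2 * n))" using T by (simp add: n_def)
  have arith: "S * (\<alpha> / (16 * S\<^sup>2 * m) * (4 * (S * (k * n)))) = \<alpha> / 4 * n * (k / m)"
    if "0 < S" "0 < m" for S m k :: real
    using that by (simp add: field_simps power2_eq_square)
  have dY: "T * (d * Y\<^sup>2) \<le> \<alpha> / 4 * n"
  proof -
    have "T * (d * Y\<^sup>2) \<le> T * (d * (4 * (T * (?b\<^sup>2 * n))))"
      using Y2 T d0 by (intro mult_left_mono) auto
    also have "\<dots> = \<alpha> / 4 * n * (?b\<^sup>2 / (?b\<^sup>2 + 1))"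
      unfolding d_def using arith[OF T b1] .
    also have "\<dots> \<le> \<alpha> / 4 * n * 1"
      using \<alpha> n0 b1 by (intro mult_left_mono) auto
    finally show ?thesis by simp
  qed
  \<comment> \<open>The state error tested with the response \<open>yh\<close>.\<close>
  have 1: "- integral {0..T} (\<lambda>t. (Q *v ?e t) \<bullet> yh t)
      \<le> c_state * integral {0..T} (\<lambda>t. (norm (?e t))\<^sup>2) + T * (d * Y\<^sup>2)"
  proof -
    have "- integral {0..T} (\<lambda>t. (Q *v ?e t) \<bullet> yh t) = integral {0..T} (\<lambda>t. - ((Q *v ?e t) \<bullet> yh t))" by simp
    also have "\<dots> \<le> integral {0..T} (\<lambda>t. c_state * (norm (?e t))\<^sup>2 + d * Y\<^sup>2)"
    proof (rule integral_le)
      show "(\<lambda>t. - ((Q *v ?e t) \<bullet> yh t)) integrable_on {0..T}"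
        by (intro integrable_neg int L2_matrix eL yhL)
      show "(\<lambda>t. c_state * (norm (?e t))\<^sup>2 + d * Y\<^sup>2) integrable_on {0..T}"
        by (intro integrable_add integrable_on_mult_right L2_integrable_square eL) auto
      fix t assume t: "t \<in> {0..T}"
      have "- ((Q *v ?e t) \<bullet> yh t) \<le> norm (Q *v ?e t) * norm (yh t)"
        using Cauchy_Schwarz_ineq2[of "Q *v ?e t" "yh t"] by linarith
      also have "\<dots> \<le> (?q * norm (?e t)) * Y"
        by (intro mult_mono norm_mult_le_opnorm yhY t mult_nonneg_nonneg opnorm_nonneg norm_ge_zero)
      also have "\<dots> \<le> c_state * (norm (?e t))\<^sup>2 + d * Y\<^sup>2"
        using young_inequality[OF d0, of ?q "norm (?e t)" Y] unfolding cd .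
      finally show "- ((Q *v ?e t) \<bullet> yh t) \<le> c_state * (norm (?e t))\<^sup>2 + d * Y\<^sup>2" .
    qed
    also have "\<dots> = integral {0..T} (\<lambda>t. c_state * (norm (?e t))\<^sup>2) + integral {0..T} (\<lambda>t. d * Y\<^sup>2)"
      by (intro Henstock_Kurzweil_Integration.integral_add integrable_on_mult_right L2_integrable_square eL) auto
    finally show ?thesis using T by (simp add: mult_ac)
  qed
  \<comment> \<open>The response error in its dual form.\<close>
  have 2: "- integral {0..T} (\<lambda>t. ?r t \<bullet> (B *v ?v t))
      \<le> c_adjoint * integral {0..T} (\<lambda>t. (norm (?r t))\<^sup>2) + \<alpha> / 4 * n"
  proof -
    have a4: "0 < \<alpha> / 4" using \<alpha> by simp
    have ca: "?b\<^sup>2 / (4 * (\<alpha> / 4)) = c_adjoint" by (simp add: c_adjoint_def)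
    have "- integral {0..T} (\<lambda>t. ?r t \<bullet> (B *v ?v t)) = integral {0..T} (\<lambda>t. - (?r t \<bullet> (B *v ?v t)))" by simp
    also have "\<dots> \<le> integral {0..T} (\<lambda>t. c_adjoint * (norm (?r t))\<^sup>2 + \<alpha> / 4 * (norm (?v t))\<^sup>2)"
    proof (rule integral_le)
      show "(\<lambda>t. - (?r t \<bullet> (B *v ?v t))) integrable_on {0..T}"
        by (intro integrable_neg int rL BvL)
      show "(\<lambda>t. c_adjoint * (norm (?r t))\<^sup>2 + \<alpha> / 4 * (norm (?v t))\<^sup>2) integrable_on {0..T}"
        by (intro integrable_add integrable_on_mult_right L2_integrable_square rL v)
      fix t
      have "- (?r t \<bullet> (B *v ?v t)) \<le> norm (?r t) * norm (B *v ?v t)"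
        using Cauchy_Schwarz_ineq2[of "?r t" "B *v ?v t"] by linarith
      also have "\<dots> \<le> norm (?r t) * (?b * norm (?v t))"
        by (intro mult_left_mono norm_mult_le_opnorm norm_ge_zero)
      also have "\<dots> = ?b * norm (?r t) * norm (?v t)" by simp
      also have "\<dots> \<le> c_adjoint * (norm (?r t))\<^sup>2 + \<alpha> / 4 * (norm (?v t))\<^sup>2"
        using young_inequality[OF a4, of ?b "norm (?r t)" "norm (?v t)"] unfolding ca .
      finally show "- (?r t \<bullet> (B *v ?v t)) \<le> c_adjoint * (norm (?r t))\<^sup>2 + \<alpha> / 4 * (norm (?v t))\<^sup>2" .
    qed
    also have "\<dots> = integral {0..T} (\<lambda>t. c_adjoint * (norm (?r t))\<^sup>2) + integral {0..T} (\<lambda>t. \<alpha> / 4 * (norm (?v t))\<^sup>2)"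
      by (intro Henstock_Kurzweil_Integration.integral_add integrable_on_mult_right L2_integrable_square rL v)
    finally show ?thesis by (simp add: n_def)
  qed
  show ?thesis using exp split adj stat psd coer 1 2 dY by (simp add: field_simps)
qed

lemma cost_perturbation:
  fixes F G :: "real \<Rightarrow> real^'n^'n"
  assumes F: "admissible T F" and G: "admissible T G" and u: "u \<in> L2 T"
  defines "e \<equiv> \<lambda>t. state_of F u t - state_of G u t"
  shows "\<bar>cost_of F u - cost_of G u\<bar>
    \<le> integral {0..T} (\<lambda>t. norm (Q *v (state_of G u t - xd t)) * norm (e t))
      + opnorm Q / 2 * integral {0..T} (\<lambda>t. (norm (e t))\<^sup>2)"
proof -
  let ?a = "\<lambda>t. state_of G u t - xd t"
  have ec: "continuous_on {0..T} e" unfolding e_def by (intro continuous_intros state_cont F G u)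
  note aL = misfit_L2[OF G u] and eL = L2_continuous[OF ec]
  have gL: "(\<lambda>t. Q *v ?a t) \<in> L2 T" by (rule L2_matrix[OF aL])
  have fx: "state_of F u t - xd t = ?a t + 1 *\<^sub>R e t" for t by (simp add: e_def)
  have "cost_of F u = 1/2 * (integral {0..T} (\<lambda>t. (?a t + 1 *\<^sub>R e t) \<bullet> (Q *v (?a t + 1 *\<^sub>R e t)))
      + integral {0..T} (\<lambda>t. u t \<bullet> (R *v u t)))"
    unfolding cost_split[OF misfit_L2[OF F u] u] fx ..
  then have eq: "cost_of F u - cost_of G u = integral {0..T} (\<lambda>t. (Q *v ?a t) \<bullet> e t)
      + 1/2 * integral {0..T} (\<lambda>t. e t \<bullet> (Q *v e t))"
    unfolding quadratic_expansion[OF Q_sym aL eL] cost_split[OF aL u] by (simp add: field_simps)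
  have "norm (integral {0..T} (\<lambda>t. (Q *v ?a t) \<bullet> e t)) \<le> integral {0..T} (\<lambda>t. norm (Q *v ?a t) * norm (e t))"
  proof (rule integral_norm_bound_integral)
    have "(\<lambda>t. norm (Q *v ?a t) \<bullet> norm (e t)) absolutely_integrable_on {0..T}"
      by (intro integrable_inner_continuous continuous_intros ec
          absolutely_integrable_norm[unfolded o_def] L2_absolutely_integrable gL)
    then show "(\<lambda>t. norm (Q *v ?a t) * norm (e t)) integrable_on {0..T}"
      by (auto intro: set_lebesgue_integral_eq_integral(1))
    show "(\<lambda>t. (Q *v ?a t) \<bullet> e t) integrable_on {0..T}"
      by (intro set_lebesgue_integral_eq_integral(1) L2_inner_integrable gL eL)
  qed (simp add: Cauchy_Schwarz_ineq2)
  moreover have "norm (integral {0..T} (\<lambda>t. e t \<bullet> (Q *v e t))) \<le> integral {0..T} (\<lambda>t. opnorm Q * (norm (e t))\<^sup>2)"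
  proof (rule integral_norm_bound_integral)
    show "(\<lambda>t. e t \<bullet> (Q *v e t)) integrable_on {0..T}"
      by (intro set_lebesgue_integral_eq_integral(1) L2_inner_integrable L2_matrix eL)
    show "(\<lambda>t. opnorm Q * (norm (e t))\<^sup>2) integrable_on {0..T}"
      by (intro integrable_on_mult_right L2_integrable_square eL)
    fix t
    have "norm (e t \<bullet> (Q *v e t)) \<le> norm (e t) * norm (Q *v e t)" by (simp add: Cauchy_Schwarz_ineq2)
    also have "\<dots> \<le> norm (e t) * (opnorm Q * norm (e t))"
      by (intro mult_left_mono norm_mult_le_opnorm norm_ge_zero)
    finally show "norm (e t \<bullet> (Q *v e t)) \<le> opnorm Q * (norm (e t))\<^sup>2" by (simp add: power2_eq_square mult_ac)
  qed
  ultimately show ?thesis unfolding eq by (simp add: abs_le_iff)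
qed

end

section \<open>The sampled matrices and the reversed grid\<close>

lemma A_h_step_fun: "A_h M S p Am K tg w = step_fun tg K (\<lambda>k. sampled_matrix M S p Am (w k))"
  by (rule ext) (simp add: A_h_def step_fun_def)

text \<open>After exchanging the sums, the probabilities of the subsets that contain \<open>m\<close> add up to the
  normalization by which \<open>Am m\<close> is divided.\<close>

lemma sampled_matrix_mean:
  assumes S: "bij_betw S {1..2^M} (Pow {1..M})" and pos: "\<And>m. m \<in> {1..M} \<Longrightarrow> sel_prob M S p m > 0"
  shows "(\<Sum>i=1..2^M. p i *\<^sub>R sampled_matrix M S p Am i) = (\<Sum>m=1..M. Am m)"
proof -
  have sub: "S i \<subseteq> {1..M}" if "i \<in> {1..2^M}" for i
    using bij_betwE[OF S] that by auto
  have "(\<Sum>i=1..2^M. p i *\<^sub>R sampled_matrix M S p Am i)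
      = (\<Sum>i=1..2^M. \<Sum>m=1..M. (if m \<in> S i then p i else 0) *\<^sub>R ((1 / sel_prob M S p m) *\<^sub>R Am m))"
  proof (rule sum.cong[OF refl])
    fix i assume i: "i \<in> {1..(2::nat)^M}"
    have "(\<Sum>m=1..M. (if m \<in> S i then p i else 0) *\<^sub>R ((1 / sel_prob M S p m) *\<^sub>R Am m))
        = (\<Sum>m\<in>S i. p i *\<^sub>R ((1 / sel_prob M S p m) *\<^sub>R Am m))"
      by (rule sum.mono_neutral_cong_right) (use sub[OF i] in auto)
    then show "p i *\<^sub>R sampled_matrix M S p Am i
        = (\<Sum>m=1..M. (if m \<in> S i then p i else 0) *\<^sub>R ((1 / sel_prob M S p m) *\<^sub>R Am m))"
      by (simp add: sampled_matrix_def scaleR_sum_right)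
  qed
  also have "\<dots> = (\<Sum>m=1..M. \<Sum>i=1..2^M. (if m \<in> S i then p i else 0) *\<^sub>R ((1 / sel_prob M S p m) *\<^sub>R Am m))"
    by (rule sum.swap)
  also have "\<dots> = (\<Sum>m=1..M. Am m)"
  proof (rule sum.cong[OF refl])
    fix m assume m: "m \<in> {1..M}"
    have "(\<Sum>i=1..2^M. (if m \<in> S i then p i else 0)) = sel_prob M S p m"
      by (simp add: sel_prob_def sum.If_cases Int_def)
    then show "(\<Sum>i=1..2^M. (if m \<in> S i then p i else 0) *\<^sub>R ((1 / sel_prob M S p m) *\<^sub>R Am m)) = Am m"
      using pos[OF m] by (simp only: scaleR_sum_left[symmetric]) simp
  qed
  finally show ?thesis .
qed

lemma transpose_diff: "transpose (X - Y) = transpose X - transpose Y" for X Y :: "real^'n^'m"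
  by (simp add: transpose_def vec_eq_iff)

lemma transpose_sum_mult:
  fixes X :: "'i \<Rightarrow> real^'n^'n"
  assumes "(\<Sum>i\<in>I. c i *\<^sub>R X i) = Y"
  shows "(\<Sum>i\<in>I. c i *\<^sub>R (transpose (X i) *v v)) = transpose Y *v v"
proof (rule vector_eq_ldot[THEN iffD1, rule_format])
  fix w
  have "w \<bullet> (\<Sum>i\<in>I. c i *\<^sub>R (transpose (X i) *v v)) = (\<Sum>i\<in>I. c i * (v \<bullet> (X i *v w)))"
    by (simp only: inner_sum_right inner_scaleR_right inner_commute[of w] inner_transpose_mult)
  also have "\<dots> = v \<bullet> (Y *v w)"
    unfolding assms[symmetric] sum_matrix_vector inner_sum_right
    by (simp add: scaleR_matrix_vector_assoc[symmetric])
  also have "\<dots> = w \<bullet> (transpose Y *v v)" by (simp only: inner_commute[of w] inner_transpose_mult)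
  finally show "w \<bullet> (\<Sum>i\<in>I. c i *\<^sub>R (transpose (X i) *v v)) = w \<bullet> (transpose Y *v v)" .
qed

lemma (in grid) grid_reverse: "grid T K (\<lambda>k. T - \<tau> (K - k)) h"
  (is "grid T K ?r h")
proof
  show "?r 0 = 0" "?r K = T" by (simp_all add: grid_0 grid_K)
  fix k assume k: "k \<in> {1..K}"
  have l: "Suc K - k \<in> {1..K}" "K - (k - 1) = Suc K - k" "K - k = Suc K - k - 1" using k by auto
  have swap: "b < a \<Longrightarrow> T - a < T - b" "a - b \<le> h \<Longrightarrow> (T - b) - (T - a) \<le> h" for a b :: real
    by simp_all
  show "?r (k-1) < ?r k" "?r k - ?r (k-1) \<le> h"
    unfolding l(2,3) by (rule swap, rule grid_less[OF l(1)], rule swap, rule grid_spacing[OF l(1)])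
qed

lemma step_fun_transpose:
  fixes H :: "nat \<Rightarrow> real^'n^'m"
  shows "step_fun \<tau> K (\<lambda>k. transpose (H k)) t = transpose (step_fun \<tau> K H t)"
proof -
  have "transpose (\<Sum>k\<in>I. X k) = (\<Sum>k\<in>I. transpose (X k))" for I and X :: "nat \<Rightarrow> real^'n^'m"
    by (simp add: transpose_def vec_eq_iff)
  then show ?thesis
    unfolding step_fun_def by (auto simp: transpose_def vec_eq_iff intro!: sum.cong)
qed

text \<open>The grid points are exceptional: reversal exchanges open and closed ends of the cells.\<close>

lemma (in grid) step_fun_reverse:
  assumes t: "t \<in> {0..T} - (\<lambda>k. T - \<tau> (K - k)) ` {0..K}"
  shows "step_fun (\<lambda>k. T - \<tau> (K - k)) K (\<lambda>k. H (Suc K - k)) t = step_fun \<tau> K H (T - t)"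
    (is "step_fun ?r _ _ _ = _")
proof -
  interpret rev: grid T K ?r h by (rule grid_reverse)
  have ts: "t \<noteq> ?r k" if "k \<le> K" for k using t that by auto
  have tT: "t \<in> {0..T}" using t by (rule DiffD1)
  then have "t < T" using ts[of K] grid_0 by (simp add: less_le)
  have "0 \<le> t" using tT by simp
  then obtain k where k: "k \<in> {1..K}" "?r (k-1) \<le> t" "t < ?r k"
    using \<open>t < T\<close> by (rule rev.grid_cell)
  have "k - 1 \<le> K" using k(1) by auto
  then have less: "?r (k-1) < t" using ts[of "k-1"] k(2) by (metis less_eq_real_def)
  have l: "Suc K - k \<in> {1..K}" and eq: "K - (k - 1) = Suc K - k" "K - k = Suc K - k - 1"
    using k(1) by auto
  have swap: "T - a < t \<Longrightarrow> T - t < a" "t < T - a \<Longrightarrow> a \<le> T - t" for a :: real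
    by simp_all
  have l': "\<tau> (Suc K - k - 1) \<le> T - t" "T - t < \<tau> (Suc K - k)"
    using swap(2)[OF k(3)] swap(1)[OF less] unfolding eq .
  show ?thesis unfolding rev.step_fun_cell[OF k] step_fun_cell[OF l l'] ..
qed

section \<open>Expected gap of the optimal values\<close>

definition err_const :: "real \<Rightarrow> real \<Rightarrow> real \<Rightarrow> real" where
  "err_const T X a = T * (2 * X\<^sup>2 + X * a) * exp (T * X * a * T)"

lemma err_const_nonneg: "0 \<le> T \<Longrightarrow> 0 \<le> X \<Longrightarrow> 0 \<le> a \<Longrightarrow> 0 \<le> err_const T X a"
  by (simp add: err_const_def)

context lq_problem
begin

text \<open>\<open>X_bound\<close> bounds all states under \<open>u\<^sup>*\<close> and \<open>G_bound\<close> the integral of \<open>|Q(x - x\<^sub>d)|\<close>; both avoid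
  \<open>u\<^sup>*\<close> by means of \<open>J(0)\<close>. The adjoint starts from 0 and is driven by this misfit, whence the argument \<open>2 * G_bound A\<close>.\<close>

definition "X_bound A = norm x0 + 2 * (opnorm B * (T + 2 / \<alpha> * J T A B x0 Q R xd (\<lambda>_. 0)))"
definition "G_bound A = opnorm Q * (T * X_bound A + integral {0..T} (\<lambda>t. norm (xd t)))"
definition "D_state A = err_const T (X_bound A) (opnorm A)"
definition "D_adjoint A = err_const T (2 * G_bound A) (opnorm (transpose A))"
definition "rate_const A = (opnorm Q / 2 + c_state) * (T * D_state A) + c_adjoint * (T * D_adjoint A)"

lemma zero_L2: "(\<lambda>_. 0) \<in> L2 T"
  by (rule L2_continuous) simp

text \<open>Comparison with the zero control: \<open>\<alpha>/2 \<integral>|u|\<^sup>2 \<le> J(u) \<le> J(0)\<close>, while \<open>|u| \<le> 1 + |u|\<^sup>2\<close> bounds the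
  integral of \<open>|u|\<close>.\<close>

lemma minimizer_bound:
  assumes u: "u \<in> L2 T" and min: "\<And>w. w \<in> L2 T \<Longrightarrow> cost_of (\<lambda>t. A) u \<le> cost_of (\<lambda>t. A) w"
  shows "norm x0 + 2 * integral {0..T} (\<lambda>t. norm (B *v u t)) \<le> X_bound A"
proof -
  have Bi: "(\<lambda>t. norm (B *v u t)) integrable_on {0..T}"
    using absolutely_integrable_norm[OF forcing[OF u]]
    by (simp add: o_def set_lebesgue_integral_eq_integral(1))
  have "integral {0..T} (\<lambda>t. norm (B *v u t)) \<le> integral {0..T} (\<lambda>t. opnorm B * (1 + (norm (u t))\<^sup>2))"
  proof (rule integral_le[OF Bi])
    show "(\<lambda>t. opnorm B * (1 + (norm (u t))\<^sup>2)) integrable_on {0..T}"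
      by (intro integrable_on_mult_right integrable_add L2_integrable_square u) auto
    fix t
    have "norm (u t) \<le> 1 + (norm (u t))\<^sup>2"
      using sum_squares_bound[of 1 "norm (u t)"] norm_ge_zero[of "u t"]
      unfolding power_one mult_1_right by linarith
    then have "opnorm B * norm (u t) \<le> opnorm B * (1 + (norm (u t))\<^sup>2)"
      by (rule mult_left_mono[OF _ opnorm_nonneg])
    with norm_mult_le_opnorm[of B "u t"] show "norm (B *v u t) \<le> opnorm B * (1 + (norm (u t))\<^sup>2)"
      by linarith
  qed
  also have "\<dots> = opnorm B * (integral {0..T} (\<lambda>t. 1) + integral {0..T} (\<lambda>t. (norm (u t))\<^sup>2))"
    by (subst Henstock_Kurzweil_Integration.integral_add[symmetric]) (auto intro: L2_integrable_square[OF u])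
  also have "\<dots> \<le> opnorm B * (T + 2 / \<alpha> * J T A B x0 Q R xd (\<lambda>_. 0))"
  proof (rule mult_left_mono[OF _ opnorm_nonneg])
    have "\<alpha> / 2 * integral {0..T} (\<lambda>t. (norm (u t))\<^sup>2) \<le> J T A B x0 Q R xd (\<lambda>_. 0)"
      using cost_ge[OF admissible_const u, of A] min[OF zero_L2] by (simp add: J_def)
    then show "integral {0..T} (\<lambda>t. 1) + integral {0..T} (\<lambda>t. (norm (u t))\<^sup>2) \<le> T + 2 / \<alpha> * J T A B x0 Q R xd (\<lambda>_. 0)"
      using \<alpha> T by (simp add: field_simps)
  qed
  finally show ?thesis by (simp add: X_bound_def)
qed

lemma misfit_bound:
  assumes A: "dissipative A" and u: "u \<in> L2 T"
    and X: "norm x0 + 2 * integral {0..T} (\<lambda>t. norm (B *v u t)) \<le> X_bound A"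
  shows "integral {0..T} (\<lambda>t. norm (Q *v (state_of (\<lambda>t. A) u t - xd t))) \<le> G_bound A"
proof -
  let ?x = "state_of (\<lambda>t. A) u"
  have xi: "(\<lambda>t. norm (xd t)) integrable_on {0..T}"
    using absolutely_integrable_norm[OF L2_absolutely_integrable[OF xd]]
    by (simp add: o_def set_lebesgue_integral_eq_integral(1))
  have gi: "(\<lambda>t. norm (Q *v (?x t - xd t))) integrable_on {0..T}"
    using absolutely_integrable_norm[OF L2_absolutely_integrable[OF L2_matrix[OF misfit_L2[OF admissible_const u, of A], of Q]]]
    by (simp add: o_def set_lebesgue_integral_eq_integral(1))
  have "integral {0..T} (\<lambda>t. norm (Q *v (?x t - xd t))) \<le> integral {0..T} (\<lambda>t. opnorm Q * (X_bound A + norm (xd t)))"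
  proof (rule integral_le[OF gi])
    show "(\<lambda>t. opnorm Q * (X_bound A + norm (xd t))) integrable_on {0..T}"
      by (intro integrable_on_mult_right integrable_add xi) auto
    fix t assume t: "t \<in> {0..T}"
    have "norm (?x t) \<le> norm x0 + 2 * integral {0..T} (\<lambda>t. norm (B *v u t))"
      using T by (intro dissipative_bound[OF admissible_const forcing[OF u] state_sol A t] admissible_const u) auto
    then have "norm (?x t - xd t) \<le> X_bound A + norm (xd t)"
      using X norm_triangle_ineq4[of "?x t" "xd t"] by linarith
    then show "norm (Q *v (?x t - xd t)) \<le> opnorm Q * (X_bound A + norm (xd t))"
      by (rule order_trans[OF norm_mult_le_opnorm mult_left_mono[OF _ opnorm_nonneg]])
  qed
  also have "\<dots> = opnorm Q * (integral {0..T} (\<lambda>t. X_bound A) + integral {0..T} (\<lambda>t. norm (xd t)))"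
    by (subst Henstock_Kurzweil_Integration.integral_add[symmetric]) (auto intro: xi)
  finally show ?thesis using T by (simp add: G_bound_def mult.commute)
qed

text \<open>The pathwise bounds \<open>suboptimality\<close> and \<open>cost_perturbation\<close> are integrated over the samples with the
  help of \<open>expected_error\<close>, applied to the state and, on the reversed grid, to the adjoint. The term linear in the state error only
  admits the first moment, which is where the square root arises.\<close>

lemma expected_value_gap:
  fixes A :: "real^'n^'n"
  assumes split: "A = (\<Sum>m=1..M. Am m)" and S: "bij_betw S {1..2^M} (Pow {1..M})"
    and p: "\<And>i. i \<in> {1..2^M} \<Longrightarrow> 0 \<le> p i" "(\<Sum>i=1..2^M. p i) = 1"
    and tg: "grid T K tg h"
    and diss: "\<And>m. m \<in> {1..M} \<Longrightarrow> dissipative (Am m)"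
    and sel: "\<And>m. m \<in> {1..M} \<Longrightarrow> sel_prob M S p m > 0"
    and u: "u \<in> L2 T" and umin: "\<And>w. w \<in> L2 T \<Longrightarrow> J T A B x0 Q R xd u \<le> J T A B x0 Q R xd w"
    and uh: "\<And>w. w \<in> Omega_K M K \<Longrightarrow> uh w \<in> L2 T"
    and uhmin: "\<And>w v. w \<in> Omega_K M K \<Longrightarrow> v \<in> L2 T \<Longrightarrow>
      J_h T B x0 Q R xd M S p Am K tg w (uh w) \<le> J_h T B x0 Q R xd M S p Am K tg w v"
  shows "expect M K p (\<lambda>w. \<bar>J_h T B x0 Q R xd M S p Am K tg w (uh w) - J T A B x0 Q R xd u\<bar>)
    \<le> G_bound A * sqrt (D_state A * (h * Var_A M S p Am A)) + rate_const A * (h * Var_A M S p Am A)"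
proof -
  define L where "L = sampled_matrix M S p Am"
  interpret g: grid T K tg h by (rule tg)
  interpret s: sampling M K p by unfold_locales (use p in auto)
  have sub: "S i \<subseteq> {1..M}" if "i \<in> {1..2^M}" for i using bij_betwE[OF S] that by auto
  have Ld: "dissipative (L i)" if i: "i \<in> {1..2^M}" for i
    unfolding L_def sampled_matrix_def
  proof (rule dissipative_sum)
    fix m assume "m \<in> S i"
    then have m: "m \<in> {1..M}" using sub[OF i] by auto
    show "dissipative ((1 / sel_prob M S p m) *\<^sub>R Am m)"
      using sel[OF m] by (intro dissipative_scaleR diss m) simp
  qed
  have Ad: "dissipative A" unfolding split by (rule dissipative_sum) (use diss in auto)
  have mean: "(\<Sum>i=1..2^M. p i *\<^sub>R L i) = A"
    unfolding L_def split by (rule sampled_matrix_mean[OF S sel])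
  define W where "W = Var_A M S p Am A"
  have W: "(\<Sum>i=1..2^M. p i * (opnorm (L i - A))\<^sup>2) = W"
    unfolding W_def Var_A_def L_def by (simp add: mult.commute)
  interpret f: random_system M K p T tg h L A "\<lambda>k. k" W
  proof
    show "(\<Sum>i=1..2^M. p i *\<^sub>R (L i *v v)) = A *v v" for v
      unfolding mean[symmetric] sum_matrix_vector by (simp add: scaleR_matrix_vector_assoc[symmetric])
  qed (use T Ld Ad W in auto)
  define W' where "W' = (\<Sum>i=1..2^M. p i * (opnorm (transpose (L i) - transpose A))\<^sup>2)"
  have W'W: "W' \<le> W"
    unfolding W'_def W[symmetric] transpose_diff[symmetric]
    by (intro sum_mono mult_left_mono power_mono opnorm_transpose_le opnorm_nonneg p(1)) auto
  interpret b: random_system M K p T "\<lambda>k. T - tg (K - k)" h "\<lambda>i. transpose (L i)" "transpose A" "\<lambda>k. Suc K - k" W'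
  proof -
    interpret rev: grid T K "\<lambda>k. T - tg (K - k)" h by (rule g.grid_reverse)
    show "random_system M K p T (\<lambda>k. T - tg (K - k)) h (\<lambda>i. transpose (L i)) (transpose A) (\<lambda>k. Suc K - k) W'"
    proof
      show "(\<Sum>i=1..2^M. p i *\<^sub>R (transpose (L i) *v v)) = transpose A *v v" for v
        by (rule transpose_sum_mult[OF mean])
      show "inj_on (\<lambda>k. Suc K - k) {1..K}" by (rule inj_onI) auto
    qed (use T Ld Ad in \<open>auto simp: W'_def intro: dissipative_transpose\<close>)
  qed
  have T0: "0 \<le> T" using T by simp
  have fF: "f.F w = A_h M S p Am K tg w" for w unfolding f.F_def A_h_step_fun by (simp only: L_def)
  let ?N = "(\<lambda>k. T - tg (K - k)) ` {0..K}"
  have bF: "b.F w t = transpose (f.F w (T - t))" if t: "t \<in> {0..T} - ?N" for w t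
  proof -
    have "step_fun (\<lambda>k. T - tg (K - k)) K (\<lambda>k. transpose (L (w (Suc K - k)))) t
        = step_fun tg K (\<lambda>k. transpose (L (w k))) (T - t)"
      by (rule g.step_fun_reverse[OF t])
    also have "\<dots> = transpose (step_fun tg K (\<lambda>k. L (w k)) (T - t))"
      by (rule step_fun_transpose)
    finally show ?thesis unfolding b.F_def f.F_def .
  qed
  have J: "J T A B x0 Q R xd w = cost_of (\<lambda>t. A) w" for w by (simp add: J_def)
  have Jh: "J_h T B x0 Q R xd M S p Am K tg w v = cost_of (f.F w) v" for w v by (simp add: J_h_def fF)
  note Ac = admissible_const[of T A]
  let ?x = "state_of (\<lambda>t. A) u" and ?xh = "\<lambda>w. state_of (f.F w) u"
  define gg where "gg = (\<lambda>t. Q *v (?x t - xd t))"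
  have ggL: "gg \<in> L2 T" unfolding gg_def by (intro L2_matrix misfit_L2 Ac u)
  have gr: "(\<lambda>s. gg (T - s)) absolutely_integrable_on {0..T}"
    by (intro absolutely_integrable_reflect_interval L2_absolutely_integrable ggL)
  obtain z where z: "lin_sol T (\<lambda>t. transpose A) (\<lambda>s. gg (T - s)) 0 z"
    using lin_sol_exists[OF T0 admissible_const gr] by blast
  have "\<forall>w. \<exists>x. lin_sol T (b.F w) (\<lambda>s. gg (T - s)) 0 x"
    by (intro allI lin_sol_exists T0 b.F_admissible gr)
  then obtain zh where "\<forall>w. lin_sol T (b.F w) (\<lambda>s. gg (T - s)) 0 (zh w)"
    unfolding choice_iff by (rule exE)
  then have zh: "\<And>w. lin_sol T (b.F w) (\<lambda>s. gg (T - s)) 0 (zh w)" by (rule spec)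
  have Xb: "norm x0 + 2 * integral {0..T} (\<lambda>t. norm (B *v u t)) \<le> X_bound A"
    by (rule minimizer_bound[OF u]) (use umin J in simp)
  have Gb: "integral {0..T} (\<lambda>t. norm (gg t)) \<le> G_bound A"
    unfolding gg_def by (rule misfit_bound[OF Ad u Xb])
  have Gb': "norm (0::real^'n) + 2 * integral {0..T} (\<lambda>s. norm (gg (T - s))) \<le> 2 * G_bound A"
    using Gb integral_reflect_interval[of 0 T "\<lambda>s. norm (gg s)"] by simp
  define e where "e = (\<lambda>w t. ?xh w t - ?x t)"
  define r where "r = (\<lambda>w t. zh w t - z t)"
  have ec: "continuous_on {0..T} (e w)" for w
    unfolding e_def by (intro continuous_intros state_cont f.F_admissible Ac u)
  have rc: "continuous_on {0..T} (\<lambda>t. r w (T - t))" for w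
  proof -
    have "continuous_on {0..T} (r w)"
      unfolding r_def using z zh[of w] by (intro continuous_intros) (auto simp: lin_sol_def)
    then show ?thesis
      by (rule continuous_on_compose2[where f="\<lambda>t. T - t"]) (auto intro!: continuous_intros)
  qed
  have Ee: "s.E (\<lambda>w. (norm (e w t))\<^sup>2) \<le> D_state A * (h * W)" if t: "t \<in> {0..T}" for t
    unfolding D_state_def err_const_def e_def
    by (rule f.expected_error[OF forcing[OF u] state_sol[OF T0 Ac u] state_sol[OF T0 f.F_admissible u] Xb t])
  have h0: "0 \<le> h"
  proof -
    have "1 \<in> {1..K}" using g.grid_0 g.grid_K T by (cases K) auto
    from g.grid_less[OF this] g.grid_spacing[OF this] show ?thesis by linarith
  qed
  have W0: "0 \<le> W" unfolding W[symmetric] by (intro sum_nonneg mult_nonneg_nonneg p(1)) auto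
  have X0: "0 \<le> X_bound A" and G0: "0 \<le> G_bound A"
  proof -
    have "0 \<le> integral {0..T} (\<lambda>t. norm (B *v u t))" "0 \<le> integral {0..T} (\<lambda>t. norm (gg t))"
      using absolutely_integrable_norm[OF forcing[OF u]] absolutely_integrable_norm[OF L2_absolutely_integrable[OF ggL]]
      by (auto simp: o_def intro!: Henstock_Kurzweil_Integration.integral_nonneg set_lebesgue_integral_eq_integral(1))
    then show "0 \<le> X_bound A" "0 \<le> G_bound A" using Xb Gb norm_ge_zero[of x0] by linarith+
  qed
  have Ds: "0 \<le> D_state A" and Da: "0 \<le> D_adjoint A"
    unfolding D_state_def D_adjoint_def by (intro err_const_nonneg T0 X0 G0 opnorm_nonneg mult_nonneg_nonneg; simp)+
  have Er: "s.E (\<lambda>w. (norm (r w (T - t)))\<^sup>2) \<le> D_adjoint A * (h * W)" if t: "t \<in> {0..T}" for t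
  proof -
    have "s.E (\<lambda>w. (norm (r w (T - t)))\<^sup>2) \<le> D_adjoint A * (h * W')"
      unfolding D_adjoint_def err_const_def r_def
      by (rule b.expected_error[OF gr z zh Gb']) (use t in auto)
    also have "\<dots> \<le> D_adjoint A * (h * W)" by (intro mult_left_mono W'W h0 Da)
    finally show ?thesis .
  qed
  have cs: "0 \<le> c_state" "0 \<le> c_adjoint" unfolding c_state_def c_adjoint_def using \<alpha> by simp_all
  let ?I1 = "\<lambda>w. integral {0..T} (\<lambda>t. norm (gg t) * norm (e w t))"
  let ?I2 = "\<lambda>w. integral {0..T} (\<lambda>t. (norm (e w t))\<^sup>2)"
  let ?I3 = "\<lambda>w. integral {0..T} (\<lambda>t. (norm (r w (T - t)))\<^sup>2)"
  have path: "\<bar>cost_of (f.F w) (uh w) - cost_of (\<lambda>t. A) u\<bar>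
      \<le> ?I1 w + ((opnorm Q / 2 + c_state) * ?I2 w + c_adjoint * ?I3 w)" if w: "w \<in> Omega_K M K" for w
  proof -
    have 1: "cost_of (f.F w) u - cost_of (f.F w) (uh w) \<le> c_state * ?I2 w + c_adjoint * ?I3 w"
      unfolding e_def r_def
      by (rule suboptimality[OF Ad f.F_admissible f.F_diss[OF w] b.F_admissible _ bF u _ uh[OF w]
            z[unfolded gg_def] zh[unfolded gg_def]])
        (use umin[unfolded J] in auto)
    have 2: "\<bar>cost_of (f.F w) u - cost_of (\<lambda>t. A) u\<bar> \<le> ?I1 w + opnorm Q / 2 * ?I2 w"
      unfolding e_def gg_def by (rule cost_perturbation[OF f.F_admissible Ac u])
    have 3: "cost_of (f.F w) (uh w) \<le> cost_of (f.F w) u" using uhmin[OF w u] by (simp add: Jh)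
    show ?thesis using 1 2 3 by (simp add: algebra_simps abs_le_iff)
  qed
  have e2i: "(\<lambda>t. (norm (e w t))\<^sup>2) integrable_on {0..T}" for w
    by (intro integrable_continuous_real continuous_intros ec)
  have r2i: "(\<lambda>t. (norm (r w (T - t)))\<^sup>2) integrable_on {0..T}" for w
    by (intro integrable_continuous_real continuous_intros rc)
  have ggn: "(\<lambda>t. norm (gg t)) absolutely_integrable_on {0..T}"
    by (rule absolutely_integrable_norm[OF L2_absolutely_integrable[OF ggL], unfolded o_def])
  have gei: "(\<lambda>t. norm (gg t) * norm (e w t)) integrable_on {0..T}" for w
    using integrable_inner_continuous[OF ggn continuous_on_norm[OF ec[of w]]]
    by (auto intro: set_lebesgue_integral_eq_integral(1))
  have E2: "s.E ?I2 \<le> T * D_state A * (h * W)"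
  proof -
    have "s.E ?I2 = integral {0..T} (\<lambda>t. s.E (\<lambda>w. (norm (e w t))\<^sup>2))"
      by (rule s.expect_integral[symmetric, OF e2i])
    also have "\<dots> \<le> integral {0..T} (\<lambda>t. D_state A * (h * W))"
      by (intro integral_le s.expect_integrable e2i Ee) auto
    finally show ?thesis using T by (simp add: mult_ac)
  qed
  have E3: "s.E ?I3 \<le> T * D_adjoint A * (h * W)"
  proof -
    have "s.E ?I3 = integral {0..T} (\<lambda>t. s.E (\<lambda>w. (norm (r w (T - t)))\<^sup>2))"
      by (rule s.expect_integral[symmetric, OF r2i])
    also have "\<dots> \<le> integral {0..T} (\<lambda>t. D_adjoint A * (h * W))"
      by (intro integral_le s.expect_integrable r2i Er) auto
    finally show ?thesis using T by (simp add: mult_ac)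
  qed
  let ?s = "sqrt (D_state A * (h * W))"
  have E1: "s.E ?I1 \<le> G_bound A * ?s"
  proof -
    have "s.E ?I1 = integral {0..T} (\<lambda>t. s.E (\<lambda>w. norm (gg t) * norm (e w t)))"
      by (rule s.expect_integral[symmetric, OF gei])
    also have "\<dots> \<le> integral {0..T} (\<lambda>t. norm (gg t) * ?s)"
    proof (rule integral_le)
      show "(\<lambda>t. norm (gg t) * ?s) integrable_on {0..T}"
        by (rule integrable_on_mult_left[OF set_lebesgue_integral_eq_integral(1)[OF ggn]])
      show "(\<lambda>t. s.E (\<lambda>w. norm (gg t) * norm (e w t))) integrable_on {0..T}"
        by (rule s.expect_integrable[OF gei])
      fix t assume t: "t \<in> {0..T}"
      have "s.E (\<lambda>w. norm (e w t)) \<le> ?s"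
        by (rule real_le_rsqrt[OF order_trans[OF s.expect_sq_le Ee[OF t]]])
      then show "s.E (\<lambda>w. norm (gg t) * norm (e w t)) \<le> norm (gg t) * ?s"
        unfolding s.expect_cmult by (rule mult_left_mono) simp
    qed
    also have "\<dots> = integral {0..T} (\<lambda>t. norm (gg t)) * ?s" by simp
    also have "\<dots> \<le> G_bound A * ?s" using Ds h0 W0 by (intro mult_right_mono Gb) simp
    finally show ?thesis .
  qed
  have "s.E (\<lambda>w. \<bar>J_h T B x0 Q R xd M S p Am K tg w (uh w) - J T A B x0 Q R xd u\<bar>)
      \<le> s.E (\<lambda>w. ?I1 w + ((opnorm Q / 2 + c_state) * ?I2 w + c_adjoint * ?I3 w))"
    unfolding J Jh by (rule s.expect_mono[OF path])
  also have "\<dots> = s.E ?I1 + ((opnorm Q / 2 + c_state) * s.E ?I2 + c_adjoint * s.E ?I3)"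
    unfolding s.expect_add s.expect_cmult ..
  also have "\<dots> \<le> G_bound A * ?s + ((opnorm Q / 2 + c_state) * (T * D_state A * (h * W))
      + c_adjoint * (T * D_adjoint A * (h * W)))"
    using cs opnorm_nonneg[of Q] by (intro add_mono mult_left_mono E1 E2 E3) auto
  also have "\<dots> = G_bound A * ?s + rate_const A * (h * W)"
    by (simp add: rate_const_def algebra_simps)
  finally show ?thesis unfolding W_def .
qed

end

theorem mainTheorem3:
  fixes A :: "real^'n^'n" and B :: "real^'q^'n" and x0 :: "real^'n" and T :: real
    and xd :: "real \<Rightarrow> real^'n" and Q :: "real^'n^'n" and R :: "real^'q^'q"
  assumes "T > 0"
    and "xd \<in> L2 T"
    and "symmetric_matrix Q" and "pos_semidef Q"
    and "symmetric_matrix R" and "pos_def R"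
  shows "\<exists>C::real. \<forall>(M::nat) (Am :: nat \<Rightarrow> real^'n^'n) (S :: nat \<Rightarrow> nat set) (p :: nat \<Rightarrow> real)
      (K::nat) (tg :: nat \<Rightarrow> real)
      (ustar :: real \<Rightarrow> real^'q) (uhstar :: (nat \<Rightarrow> nat) \<Rightarrow> real \<Rightarrow> real^'q).
      A = (\<Sum>m=1..M. Am m) \<longrightarrow>
      bij_betw S {1..2^M} (Pow {1..M}) \<longrightarrow>
      (\<forall>i\<in>{1..2^M}. 0 \<le> p i) \<longrightarrow>
      tg 0 = 0 \<longrightarrow> tg K = T \<longrightarrow> (\<forall>k\<in>{1..K}. tg (k-1) < tg k) \<longrightarrow>
      (\<forall>m\<in>{1..M}. \<forall>x. x \<bullet> (Am m *v x) \<le> 0) \<longrightarrow>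
      (\<Sum>i=1..2^M. p i) = 1 \<longrightarrow>
      (\<forall>m\<in>{1..M}. sel_prob M S p m > 0) \<longrightarrow>
      is_arg_min (J T A B x0 Q R xd) (\<lambda>u. u \<in> L2 T) ustar \<longrightarrow>
      (\<forall>\<omega>\<in>Omega_K M K.
         is_arg_min (J_h T B x0 Q R xd M S p Am K tg \<omega>) (\<lambda>u. u \<in> L2 T) (uhstar \<omega>)) \<longrightarrow>
      expect M K p
        (\<lambda>\<omega>. \<bar>J_h T B x0 Q R xd M S p Am K tg \<omega> (uhstar \<omega>) - J T A B x0 Q R xd ustar\<bar>)
      \<le> C * (sqrt (max_spacing K tg * Var_A M S p Am A) + max_spacing K tg * Var_A M S p Am A)"
proof -
  obtain \<alpha> where \<alpha>: "\<alpha> > 0" "\<And>v. \<alpha> * (norm v)\<^sup>2 \<le> v \<bullet> (R *v v)"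
    using pos_def_coercive[OF assms(6)] by blast
  interpret lq_problem T B x0 xd Q R \<alpha>
    by unfold_locales (use assms \<alpha> in auto)
  \<comment> \<open>The absolute values spare a proof that the coefficients are nonnegative.\<close>
  define C where "C = \<bar>G_bound A * sqrt (D_state A)\<bar> + \<bar>rate_const A\<bar>"
  show ?thesis
  proof (rule exI[of _ C], intro allI impI)
    fix M :: nat and Am :: "nat \<Rightarrow> real^'n^'n" and S :: "nat \<Rightarrow> nat set" and p :: "nat \<Rightarrow> real"
      and K :: nat and tg :: "nat \<Rightarrow> real" and ustar :: "real \<Rightarrow> real^'q"
      and uhstar :: "(nat \<Rightarrow> nat) \<Rightarrow> real \<Rightarrow> real^'q"
    let ?h = "max_spacing K tg" and ?V = "Var_A M S p Am A"
    assume split: "A = (\<Sum>m=1..M. Am m)" and S: "bij_betw S {1..2^M} (Pow {1..M})"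
      and p: "\<forall>i\<in>{1..2^M}. 0 \<le> p i" and t0: "tg 0 = 0" and tK: "tg K = T"
      and tless: "\<forall>k\<in>{1..K}. tg (k-1) < tg k"
      and diss: "\<forall>m\<in>{1..M}. \<forall>x. x \<bullet> (Am m *v x) \<le> 0"
      and p1: "(\<Sum>i=1..2^M. p i) = 1" and sel: "\<forall>m\<in>{1..M}. sel_prob M S p m > 0"
      and u: "is_arg_min (J T A B x0 Q R xd) (\<lambda>u. u \<in> L2 T) ustar"
      and uh: "\<forall>\<omega>\<in>Omega_K M K.
         is_arg_min (J_h T B x0 Q R xd M S p Am K tg \<omega>) (\<lambda>u. u \<in> L2 T) (uhstar \<omega>)"
    have grid: "grid T K tg ?h"
    proof
      show "tg k - tg (k-1) \<le> ?h" if "k \<in> {1..K}" for k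
        unfolding max_spacing_def by (rule Max_ge) (use that in auto)
    qed (use t0 tK tless in auto)
    have "expect M K p (\<lambda>w. \<bar>J_h T B x0 Q R xd M S p Am K tg w (uhstar w) - J T A B x0 Q R xd ustar\<bar>)
        \<le> G_bound A * sqrt (D_state A * (?h * ?V)) + rate_const A * (?h * ?V)"
    proof (rule expected_value_gap[OF split S _ p1 grid])
      show "0 \<le> p i" if "i \<in> {1..2^M}" for i using p that by blast
      show "dissipative (Am m)" if "m \<in> {1..M}" for m using diss that unfolding dissipative_def by blast
      show "sel_prob M S p m > 0" if "m \<in> {1..M}" for m using sel that by blast
      show "ustar \<in> L2 T" using u by (simp add: is_arg_min_def)
      show "J T A B x0 Q R xd ustar \<le> J T A B x0 Q R xd v" if "v \<in> L2 T" for v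
        using u that unfolding is_arg_min_def by (meson not_le)
      show "uhstar w \<in> L2 T" if "w \<in> Omega_K M K" for w
        using bspec[OF uh that] by (simp add: is_arg_min_def)
      show "J_h T B x0 Q R xd M S p Am K tg w (uhstar w) \<le> J_h T B x0 Q R xd M S p Am K tg w v"
        if "w \<in> Omega_K M K" "v \<in> L2 T" for w v
        using bspec[OF uh that(1)] that(2) unfolding is_arg_min_def by (meson not_le)
    qed
    also have "\<dots> = (G_bound A * sqrt (D_state A)) * sqrt (?h * ?V) + rate_const A * (?h * ?V)"
      by (simp add: real_sqrt_mult)
    also have "\<dots> \<le> C * sqrt (?h * ?V) + C * (?h * ?V)"
    proof (intro add_mono mult_right_mono)
      have "K \<noteq> 0" using t0 tK assms(1) by (cases K) auto
      then have "1 \<in> {1..K}" by simp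
      then have h: "0 \<le> ?h"
        using grid.grid_less[OF grid, of 1] grid.grid_spacing[OF grid, of 1] by linarith
      have V: "0 \<le> ?V" unfolding Var_A_def using p by (intro sum_nonneg mult_nonneg_nonneg) auto
      show "0 \<le> sqrt (?h * ?V)" "0 \<le> ?h * ?V" using h V by simp_all
      show "G_bound A * sqrt (D_state A) \<le> C" "rate_const A \<le> C" unfolding C_def by linarith+
    qed
    finally show "expect M K p (\<lambda>\<omega>. \<bar>J_h T B x0 Q R xd M S p Am K tg \<omega> (uhstar \<omega>) - J T A B x0 Q R xd ustar\<bar>)
        \<le> C * (sqrt (?h * ?V) + ?h * ?V)"
      by (simp only: distrib_left)
  qed
qed

end
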